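(* Let $n=2m$ with $m\in\mathbb N$. Every matrix function $F(x)$ of class $\mathfrak F_n$ is associated with some differential expression $\ell_n(y)$ whose coefficients $\mathcal T=(\tau_\nu)_{\nu=0}^{n-1}$ belong to $\mathfrak T_n$. In other words, $$\mathfrak F_n=\bigcup_{\mathcal T\in\mathfrak T_n}\mathfrak F(\mathcal T).$$
   Context: All functions are complex-valued. $n=2m$, $m\in\mathbb N$. $\mathfrak D=C_0^\infty(0,1)$, $\mathfrak D'$ is the space of distributions on $(0,1)$. For $i\ge 0$, $W_2^{-i}[0,1]$ is the set of distributions $\sigma^{(i)}$ with $\sigma\in L_2[0,1]$ ($W_2^0=L_2$). Singularity orders: $i_{2k+j}:=m-k-j$ for $k\ge 0$, $j\in\{0,1\}$. Coefficient space: $\mathfrak T_n:=\{\mathcal T=(\tau_\nu)_{\nu=0}^{n-1}:\tau_\nu\in W_2^{-i_\nu}[0,1],\ \nu=0,\dots,n-1\}$. Differential expression with coefficients $\mathcal T$: $$\ell_n(y)=y^{(n)}+\sum_{k=0}^{m-1}(-1)^k(\tau_{2k}y^{(k)})^{(k)}+\sum_{k=0}^{m-1}(-1)^{k+1}\Bigl((\tau_{2k+1}y^{(k)})^{(k+1)}+(\tau_{2k+1}y^{(k+1)})^{(k)}\Bigr),$$ which is well defined as an element of $\mathfrak D'$ for $y\in W_2^m[0,1]$; here the product of $\tau=\sigma^{(i)}$, $\sigma\in L_2[0,1]$, and $g\in W_2^i[0,1]$ is the distribution $(\tau g,z)=(-1)^i\int_0^1\sigma\,(gz)^{(i)}\,dx$,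 $z\in\mathfrak D$. $\mathfrak F_n$ is the set of $n\times n$ matrix functions $F=[f_{k,j}]_{k,j=1}^n$ on $[0,1]$ such that for $k=m+1,\dots,n$ and $j=1,\dots,m$: $f_{k,j}\in L_1[0,1]$, $f_{m,j}\in L_2[0,1]$, $f_{k,m+1}\in L_2[0,1]$; and $f_{k,j}=0$ whenever $k<m$ or $j>m+1$ or $(k,j)=(m,m+1)$. For $F\in\mathfrak F_n$ the quasi-derivatives are $y^{[0]}:=y$, $y^{[k]}:=(y^{[k-1]})'-\sum_{j=1}^k f_{k,j}y^{[j-1]}$, $k=1,\dots,n$, and $\mathcal D_F:=\{y: y^{[k]}\in W_1^1[0,1],\ k=0,\dots,n-1\}\subset W_2^m[0,1]$. $F\in\mathfrak F_n$ is called associated with $\ell_n(y)$ if $\ell_n(y)=y^{[n]}$ for every $y\in\mathcal D_F$ (quasi-derivatives taken with respect to $F$). $\mathfrak F(\mathcal T)\subset\mathfrak F_n$ denotes the set of all matrices associated with the expression $\ell_n$ having coefficients $\mathcal T$. *)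

theory Defs
  imports "HOL-Analysis.Analysis"
begin

text \<open>
  Elements of \<open>L\<^sub>p[0,1]\<close> and Sobolev spaces are represented by functions \<^typ>\<open>real \<Rightarrow> complex\<close>;
  only their values almost everywhere on \<open>[0,1]\<close> matter.
\<close>

abbreviation I01 :: "real measure" where
  "I01 \<equiv> lebesgue_on {0..1}"

definition Lp :: "nat \<Rightarrow> (real \<Rightarrow> complex) set" where
  "Lp p = {f. f \<in> borel_measurable I01 \<and> integrable I01 (\<lambda>x. norm (f x) ^ p)}"

section \<open>Test functions and distributions on (0,1)\<close>

definition nderiv :: "nat \<Rightarrow> (real \<Rightarrow> complex) \<Rightarrow> real \<Rightarrow> complex" where
  "nderiv k = ((\<lambda>f x. vector_derivative f (at x)) ^^ k)"

definition test_funs :: "(real \<Rightarrow> complex) set" where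
  "test_funs = {z. (\<forall>k x. nderiv k z differentiable at x) \<and>
                   (\<exists>a b. 0 < a \<and> b < 1 \<and> (\<forall>x. x \<notin> {a..b} \<longrightarrow> z x = 0))}"

definition tends_to_zero_in_D :: "(nat \<Rightarrow> real \<Rightarrow> complex) \<Rightarrow> bool" where
  "tends_to_zero_in_D zs \<longleftrightarrow>
     (\<exists>a b. 0 < a \<and> b < 1 \<and> (\<forall>n x. x \<notin> {a..b} \<longrightarrow> zs n x = 0)) \<and>
     (\<forall>k. uniform_limit UNIV (\<lambda>n. nderiv k (zs n)) (\<lambda>_. 0) sequentially)"

text \<open>
  Functionals are extensional on the set of test functions, so that equality of distributions
  is equality in HOL. For linear functionals on the test functions, continuity is equivalent to
  sequential continuity at zero.
\<close>

type_synonym functional = "(real \<Rightarrow> complex) \<Rightarrow> complex"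

definition distributions :: "functional set" where
  "distributions = {T \<in> extensional test_funs.
     (\<forall>z\<in>test_funs. \<forall>w\<in>test_funs. T (\<lambda>x. z x + w x) = T z + T w) \<and>
     (\<forall>z\<in>test_funs. \<forall>c. T (\<lambda>x. c * z x) = c * T z) \<and>
     (\<forall>zs. (\<forall>n. zs n \<in> test_funs) \<longrightarrow> tends_to_zero_in_D zs \<longrightarrow> (\<lambda>n. T (zs n)) \<longlonglongrightarrow> 0)}"

definition reg :: "(real \<Rightarrow> complex) \<Rightarrow> functional" where
  "reg f = (\<lambda>z\<in>test_funs. LINT x|I01. f x * z x)"

definition dderiv :: "functional \<Rightarrow> functional" where
  "dderiv T = (\<lambda>z\<in>test_funs. - T (nderiv 1 z))"

section \<open>Weak derivatives and Sobolev spaces\<close>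

text \<open>
  The weak derivative of order \<open>i\<close>, as a function. It is determined up to almost everywhere
  equality whenever it exists in \<open>L\<^sub>1[0,1]\<close>, and is only meant to be used in that case.
\<close>

definition wderiv :: "nat \<Rightarrow> (real \<Rightarrow> complex) \<Rightarrow> real \<Rightarrow> complex" where
  "wderiv i f = (SOME g. g \<in> Lp 1 \<and> reg g = (dderiv ^^ i) (reg f))"

definition Sobolev :: "nat \<Rightarrow> nat \<Rightarrow> (real \<Rightarrow> complex) set" where
  "Sobolev k p = {f \<in> Lp p. \<forall>i\<le>k. \<exists>g\<in>Lp p. reg g = (dderiv ^^ i) (reg f)}"

text \<open>\<open>Wneg i\<close> is the space $W_2^{-i}[0,1]$.\<close>

definition Wneg :: "nat \<Rightarrow> functional set" where
  "Wneg i = {T \<in> distributions. \<exists>\<sigma>\<in>Lp 2. T = (dderiv ^^ i) (reg \<sigma>)}"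

text \<open>
  The product of \<open>\<tau> \<in> Wneg i\<close> and \<open>g \<in> Sobolev i 2\<close>. The choice of \<open>\<sigma>\<close> is immaterial: two
  choices differ almost everywhere by a polynomial of degree less than \<open>i\<close>, which the \<open>i\<close>-th
  derivative of the compactly supported \<open>g z\<close> annihilates.
\<close>

definition dmult :: "nat \<Rightarrow> functional \<Rightarrow> (real \<Rightarrow> complex) \<Rightarrow> functional" where
  "dmult i \<tau> g =
     (let \<sigma> = (SOME \<sigma>. \<sigma> \<in> Lp 2 \<and> \<tau> = (dderiv ^^ i) (reg \<sigma>))
      in (\<lambda>z\<in>test_funs. (-1) ^ i * (LINT x|I01. \<sigma> x * wderiv i (\<lambda>t. g t * z t) x)))"

section \<open>The differential expression of order 2m\<close>

text \<open>For $\nu = 2k+j$ with $j \in \{0,1\}$ and $\nu < 2m$ this is $m-k-j$, without truncation.\<close>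

definition sing_order :: "nat \<Rightarrow> nat \<Rightarrow> nat" where
  "sing_order m \<nu> = m - \<nu> div 2 - \<nu> mod 2"

definition coeff_space :: "nat \<Rightarrow> (nat \<Rightarrow> functional) set" where
  "coeff_space m = (\<Pi>\<^sub>E \<nu>\<in>{..<2*m}. Wneg (sing_order m \<nu>))"

definition diff_expr :: "nat \<Rightarrow> (nat \<Rightarrow> functional) \<Rightarrow> (real \<Rightarrow> complex) \<Rightarrow> functional" where
  "diff_expr m T y = (\<lambda>z\<in>test_funs.
     (dderiv ^^ (2*m)) (reg y) z
     + (\<Sum>k<m. (-1) ^ k *
          (dderiv ^^ k) (dmult (sing_order m (2*k)) (T (2*k)) (wderiv k y)) z)
     + (\<Sum>k<m. (-1) ^ (k+1) *
          ((dderiv ^^ (k+1)) (dmult (sing_order m (2*k+1)) (T (2*k+1)) (wderiv k y)) z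
           + (dderiv ^^ k) (dmult (sing_order m (2*k+1)) (T (2*k+1)) (wderiv (k+1) y)) z)))"

section \<open>Matrix functions, quasi-derivatives and associated matrices\<close>

text \<open>
  Entries of \<open>F\<close> are numbered from 1; those outside \<open>{1..2*m} \<times> {1..2*m}\<close> are never used.
\<close>

type_synonym matrix_fun = "nat \<Rightarrow> nat \<Rightarrow> real \<Rightarrow> complex"

definition matrix_class :: "nat \<Rightarrow> matrix_fun set" where
  "matrix_class m = {F.
     (\<forall>k\<in>{m+1..2*m}. \<forall>j\<in>{1..m}. F k j \<in> Lp 1 \<and> F m j \<in> Lp 2 \<and> F k (m+1) \<in> Lp 2) \<and>
     (\<forall>k\<in>{1..2*m}. \<forall>j\<in>{1..2*m}.
        k < m \<or> j > m + 1 \<or> (k, j) = (m, m+1) \<longrightarrow> (AE x in I01. F k j x = 0))}"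

fun quasi_deriv :: "matrix_fun \<Rightarrow> nat \<Rightarrow> (real \<Rightarrow> complex) \<Rightarrow> real \<Rightarrow> complex" where
  "quasi_deriv F 0 y = y"
| "quasi_deriv F (Suc k) y =
     (\<lambda>x. wderiv 1 (quasi_deriv F k y) x
          - (\<Sum>j\<in>{1..Suc k}. F (Suc k) j x * quasi_deriv F (j - 1) y x))"

definition quasi_domain :: "nat \<Rightarrow> matrix_fun \<Rightarrow> (real \<Rightarrow> complex) set" where
  "quasi_domain m F = {y. \<forall>k<2*m. quasi_deriv F k y \<in> Sobolev 1 1}"

definition associated :: "nat \<Rightarrow> matrix_fun \<Rightarrow> (nat \<Rightarrow> functional) \<Rightarrow> bool" where
  "associated m F T \<longleftrightarrow>
     (\<forall>y\<in>quasi_domain m F. diff_expr m T y = reg (quasi_deriv F (2*m) y))"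

definition associated_matrices :: "nat \<Rightarrow> (nat \<Rightarrow> functional) \<Rightarrow> matrix_fun set" where
  "associated_matrices m T = {F \<in> matrix_class m. associated m F T}"

section \<open>Regular functionals and their derivatives are distributions\<close>

lemma nderiv_0 [simp]: "nderiv 0 z = z"
  and nderiv_Suc: "nderiv (Suc k) z = (\<lambda>x. vector_derivative (nderiv k z) (at x))"
  by (simp_all add: nderiv_def)

lemma nderiv_nderiv: "nderiv k (nderiv l z) = nderiv (k + l) z"
  by (simp add: nderiv_def funpow_add)

lemma nderiv_add:
  assumes "z \<in> test_funs" "w \<in> test_funs"
  shows "nderiv k (\<lambda>x. z x + w x) = (\<lambda>x. nderiv k z x + nderiv k w x)"
proof (induction k)
  case (Suc k)
  show ?case
    unfolding nderiv_Suc Suc using assms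
    by (intro ext vector_derivative_add_at) (auto simp: test_funs_def)
qed simp

lemma nderiv_mult:
  assumes "z \<in> test_funs"
  shows "nderiv k (\<lambda>x. c * z x) = (\<lambda>x. c * nderiv k z x)"
proof (induction k)
  case (Suc k)
  have "((\<lambda>x. c * nderiv k z x) has_vector_derivative c * nderiv (Suc k) z x) (at x)" for x
    using assms unfolding nderiv_Suc
    by (intro has_vector_derivative_mult_right)
      (auto simp: test_funs_def vector_derivative_works)
  then show ?case
    unfolding nderiv_Suc[of k "\<lambda>x. c * z x"] Suc by (auto intro: vector_derivative_at)
qed simp

lemma nderiv_1_outside:
  assumes "\<And>x. x \<notin> {a..b} \<Longrightarrow> z x = 0" "x \<notin> {a..b}"
  shows "nderiv 1 z x = 0"
proof -
  have "(z has_vector_derivative 0) (at x)"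
  proof (rule has_vector_derivative_transform_within_open)
    show "((\<lambda>_. 0) has_vector_derivative (0::complex)) (at x)"
      by (rule has_vector_derivative_const)
    show "open (- {a..b})" by (simp only: open_Compl closed_atLeastAtMost)
    show "x \<in> - {a..b}" using assms(2) by blast
    show "0 = z y" if "y \<in> - {a..b}" for y
      using assms(1)[of y, symmetric] that by blast
  qed
  then show ?thesis by (simp add: nderiv_def vector_derivative_at)
qed

lemma test_funsI:
  assumes "\<And>k x. nderiv k z differentiable at x" "0 < a" "b < 1" "\<And>x. x \<notin> {a..b} \<Longrightarrow> z x = 0"
  shows "z \<in> test_funs"
  unfolding test_funs_def
  by (rule CollectI, rule conjI, (rule allI)+, rule assms(1), rule exI[of _ a], rule exI[of _ b],
      intro conjI allI impI, rule assms(2), rule assms(3), erule assms(4))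

lemma test_funs_support:
  "z \<in> test_funs \<Longrightarrow> \<exists>a b. 0 < a \<and> b < 1 \<and> (\<forall>x. x \<notin> {a..b} \<longrightarrow> z x = 0)"
  by (simp only: test_funs_def mem_Collect_eq)

lemma test_funs_differentiable: "z \<in> test_funs \<Longrightarrow> nderiv k z differentiable at x"
  by (simp only: test_funs_def mem_Collect_eq)

lemma test_funs_add:
  assumes z: "z \<in> test_funs" and w: "w \<in> test_funs"
  shows "(\<lambda>x. z x + w x) \<in> test_funs"
proof -
  obtain a b where ab: "0 < a" "b < 1" "\<And>x. x \<notin> {a..b} \<Longrightarrow> z x = 0"
    using test_funs_support[OF z] by blast
  obtain c d where cd: "0 < c" "d < 1" "\<And>x. x \<notin> {c..d} \<Longrightarrow> w x = 0"
    using test_funs_support[OF w] by blast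
  show ?thesis
  proof (rule test_funsI)
    show "nderiv k (\<lambda>x. z x + w x) differentiable at x" for k x
      unfolding nderiv_add[OF z w]
      by (intro differentiable_add test_funs_differentiable z w)
    show "0 < min a c" "max b d < 1" using ab cd by simp_all
    show "z x + w x = 0" if "x \<notin> {min a c..max b d}" for x
    proof -
      have "x \<notin> {a..b}" "x \<notin> {c..d}" using that by auto
      then show ?thesis using ab(3) cd(3) by simp
    qed
  qed
qed

lemma test_funs_mult:
  assumes z: "z \<in> test_funs"
  shows "(\<lambda>x. c * z x) \<in> test_funs"
proof -
  obtain a b where ab: "0 < a" "b < 1" "\<And>x. x \<notin> {a..b} \<Longrightarrow> z x = 0"
    using test_funs_support[OF z] by blast
  show ?thesis
  proof (rule test_funsI[OF _ ab(1,2)])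
    show "nderiv k (\<lambda>x. c * z x) differentiable at x" for k x
      unfolding nderiv_mult[OF z]
      by (intro differentiable_mult differentiable_const test_funs_differentiable z)
    show "c * z x = 0" if "x \<notin> {a..b}" for x using ab(3)[OF that] by simp
  qed
qed

lemma test_funs_nderiv:
  assumes z: "z \<in> test_funs"
  shows "nderiv 1 z \<in> test_funs"
proof -
  obtain a b where ab: "0 < a" "b < 1" "\<And>x. x \<notin> {a..b} \<Longrightarrow> z x = 0"
    using test_funs_support[OF z] by blast
  show ?thesis
  proof (rule test_funsI[OF _ ab(1,2)])
    show "nderiv k (nderiv 1 z) differentiable at x" for k x
      unfolding nderiv_nderiv by (rule test_funs_differentiable[OF z])
    show "nderiv 1 z x = 0" if "x \<notin> {a..b}" for x using nderiv_1_outside[OF ab(3) that] .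
  qed
qed

lemma test_funs_continuous: "z \<in> test_funs \<Longrightarrow> continuous_on UNIV z"
proof -
  assume z: "z \<in> test_funs"
  show ?thesis
    by (intro differentiable_imp_continuous_on) 
      (use test_funs_differentiable[OF z, of 0] in \<open>simp add: differentiable_on_def\<close>)
qed

lemma Lp_1_integrable: "f \<in> Lp 1 \<longleftrightarrow> integrable I01 f"
  by (auto simp: Lp_def integrable_iff_bounded)

lemma Lp_2_subset_Lp_1: "Lp 2 \<subseteq> Lp 1"
proof
  fix f assume f: "f \<in> Lp 2"
  have "finite_measure I01" by (simp add: finite_measure_lebesgue_on)
  then have "integrable I01 (\<lambda>x. norm (f x))"
    by (rule finite_measure.square_integrable_imp_integrable) (use f in \<open>auto simp: Lp_def\<close>)
  with f show "f \<in> Lp 1" by (auto simp: Lp_def)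
qed

lemma integrable_mult_test_fun:
  assumes "f \<in> Lp 1" "z \<in> test_funs"
  shows "integrable I01 (\<lambda>x. f x * z x)"
proof -
  have "continuous_on {0..1} z"
    using test_funs_continuous[OF assms(2)] continuous_on_subset by blast
  then have "compact (z ` {0..1})" and m: "z \<in> borel_measurable I01"
    by (auto intro!: compact_continuous_image continuous_imp_measurable_on_sets_lebesgue)
  then obtain B where B: "\<forall>x\<in>{0..1}. norm (z x) \<le> B"
    using compact_imp_bounded bounded_iff by (metis imageI)
  have f: "integrable I01 f" using assms(1) Lp_1_integrable by blast
  show ?thesis
  proof (rule Bochner_Integration.integrable_bound)
    show "integrable I01 (\<lambda>x. of_real B * f x)" using f by simp
    show "(\<lambda>x. f x * z x) \<in> borel_measurable I01" using m f by simp
    show "AE x in I01. norm (f x * z x) \<le> norm (of_real B * f x)"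
    proof (rule AE_I2)
      fix x :: real assume "x \<in> space I01"
      then have "norm (z x) \<le> \<bar>B\<bar>" using B by (force intro: order_trans[OF _ abs_ge_self])
      then show "norm (f x * z x) \<le> norm (of_real B * f x)"
        using mult_left_mono[of "norm (z x)" "\<bar>B\<bar>" "norm (f x)"] by (simp add: norm_mult mult.commute)
    qed
  qed
qed

lemma reg_in_distributions:
  assumes f: "f \<in> Lp 1"
  shows "reg f \<in> distributions"
proof -
  have "reg f (\<lambda>x. z x + w x) = reg f z + reg f w" if "z \<in> test_funs" "w \<in> test_funs" for z w
    using that f by (simp add: reg_def test_funs_add distrib_left integrable_mult_test_fun)
  moreover have "reg f (\<lambda>x. c * z x) = c * reg f z" if "z \<in> test_funs" for z c
    using that f by (simp add: reg_def test_funs_mult mult.left_commute[of _ c])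
  moreover have "(\<lambda>n. reg f (zs n)) \<longlonglongrightarrow> 0"
    if zs: "\<And>n. zs n \<in> test_funs" and lim: "tends_to_zero_in_D zs" for zs
  proof (rule tendstoI)
    fix e :: real assume e: "e > 0"
    have fi: "integrable I01 f" using f Lp_1_integrable by blast
    define N where "N = (LINT x|I01. norm (f x))"
    have N: "N \<ge> 0" by (simp add: N_def)
    define d where "d = e / (N + 1)"
    have d: "d > 0" "N * d < e" using e N by (simp_all add: d_def field_simps)
    have "uniform_limit UNIV (\<lambda>n. nderiv 0 (zs n)) (\<lambda>_. 0) sequentially"
      using lim unfolding tends_to_zero_in_D_def by blast
    then have "\<forall>\<^sub>F n in sequentially. \<forall>x. norm (zs n x) < d"
      using d(1) by (simp add: uniform_limit_iff)
    then show "\<forall>\<^sub>F n in sequentially. dist (reg f (zs n)) 0 < e"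
    proof eventually_elim
      case (elim n)
      have "norm (reg f (zs n)) = norm (LINT x|I01. f x * zs n x)"
        using zs by (simp add: reg_def)
      also have "\<dots> \<le> (LINT x|I01. norm (f x * zs n x))" by (rule integral_norm_bound)
      also have "\<dots> \<le> (LINT x|I01. norm (f x) * d)"
        using fi integrable_mult_test_fun[OF f zs[of n]] elim
        by (intro integral_mono)
          (auto simp: norm_mult less_imp_le intro!: mult_left_mono dest: integrable_norm)
      also have "\<dots> = N * d" by (simp add: N_def)
      finally show ?case using d by simp
    qed
  qed
  ultimately show ?thesis by (auto simp: distributions_def) (simp add: reg_def)
qed

lemma dderiv_in_distributions:
  assumes "T \<in> distributions"
  shows "dderiv T \<in> distributions"
proof -
  have "dderiv T (\<lambda>x. z x + w x) = dderiv T z + dderiv T w"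
    if "z \<in> test_funs" "w \<in> test_funs" for z w
    using that assms test_funs_nderiv[OF that(1)] test_funs_nderiv[OF that(2)]
    by (simp add: dderiv_def test_funs_add nderiv_add distributions_def del: One_nat_def)
  moreover have "dderiv T (\<lambda>x. c * z x) = c * dderiv T z" if "z \<in> test_funs" for z c
    using that assms test_funs_nderiv[OF that]
    by (simp add: dderiv_def test_funs_mult nderiv_mult distributions_def del: One_nat_def)
  moreover have "(\<lambda>n. dderiv T (zs n)) \<longlonglongrightarrow> 0"
    if zs: "\<And>n. zs n \<in> test_funs" and lim: "tends_to_zero_in_D zs" for zs
  proof -
    obtain a b where ab: "0 < a" "b < 1" "\<And>n x. x \<notin> {a..b} \<Longrightarrow> zs n x = 0"
      using lim by (auto simp: tends_to_zero_in_D_def)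
    have "\<forall>n x. x \<notin> {a..b} \<longrightarrow> nderiv 1 (zs n) x = 0"
      using ab(3) nderiv_1_outside by blast
    then have "tends_to_zero_in_D (\<lambda>n. nderiv 1 (zs n))"
      using lim ab(1,2) unfolding tends_to_zero_in_D_def nderiv_nderiv by blast
    moreover have "\<forall>n. nderiv 1 (zs n) \<in> test_funs" using test_funs_nderiv[OF zs] by blast
    moreover have "\<forall>zs. (\<forall>n. zs n \<in> test_funs) \<longrightarrow> tends_to_zero_in_D zs \<longrightarrow> (\<lambda>n. T (zs n)) \<longlonglongrightarrow> 0"
      using assms unfolding distributions_def mem_Collect_eq by (elim conjE) assumption
    ultimately have "(\<lambda>n. T (nderiv 1 (zs n))) \<longlonglongrightarrow> 0" by simp
    then show ?thesis
      using zs tendsto_minus[of "\<lambda>n. T (nderiv 1 (zs n))" 0] by (simp add: dderiv_def)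
  qed
  ultimately show ?thesis by (auto simp: distributions_def) (simp add: dderiv_def)
qed

lemma Wneg_eq: "Wneg i = (\<lambda>\<sigma>. (dderiv ^^ i) (reg \<sigma>)) ` Lp 2"
proof -
  have "(dderiv ^^ i) (reg \<sigma>) \<in> distributions" if "\<sigma> \<in> Lp 2" for \<sigma>
  proof (induction i)
    case 0
    show ?case using reg_in_distributions that Lp_2_subset_Lp_1 by (simp add: subset_iff)
  next
    case (Suc i)
    then show ?case by (simp add: dderiv_in_distributions)
  qed
  then show ?thesis by (auto simp: Wneg_def)
qed

end

theory Submission
  imports Defs
begin

text \<open>
  Write \<open>u\<^sub>r\<close> for the weak derivatives of \<open>y\<close>. Unfolding the quasi-derivatives and testing
  with \<open>z\<close> turns \<open>y\<^sup>[\<^sup>n\<^sup>]\<close> into \<open>y\<^sup>(\<^sup>n\<^sup>)\<close> plus a sum of integrals of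
  \<open>g u\<^sub>r z\<^sup>(\<^sup>s\<^sup>)\<close> with \<open>r, s \<le> m\<close>, not both equal to \<open>m\<close>, where \<open>g\<close> is square
  integrable if \<open>r\<close> or \<open>s\<close> is \<open>m\<close> and integrable otherwise. Replacing \<open>g\<close> by iterated
  primitives, it becomes a distribution of order exactly \<open>m - max r s\<close>. The product rule
  \<open>\<langle>g', u\<^sub>r z\<^sup>(\<^sup>s\<^sup>)\<rangle> = - \<langle>g, u\<^sub>r\<^sub>+\<^sub>1 z\<^sup>(\<^sup>s\<^sup>)\<rangle> - \<langle>g, u\<^sub>r z\<^sup>(\<^sup>s\<^sup>+\<^sup>1\<^sup>)\<rangle>\<close> then moves derivatives
  between the two factors until \<open>\<bar>r - s\<bar> \<le> 1\<close>, and splits a term with \<open>\<bar>r - s\<bar> = 1\<close> into an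
  antisymmetric part, which is a coefficient of odd index, and a diagonal term. By the
  du Bois-Reymond lemma, the square integrable function that represents a coefficient is unique up
  to a polynomial which the product does not see, so the coefficients found this way are the ones
  used by the differential expression.
\<close>

section \<open>Smooth functions\<close>

definition smooth :: "(real \<Rightarrow> complex) \<Rightarrow> bool" where
  "smooth f \<longleftrightarrow> (\<forall>k x. nderiv k f differentiable at x)"

text \<open>Finite sums of members of \<open>G\<close> are closed under differentiation, so every
  iterated derivative of \<open>f\<close> is such a sum. Two summands per derivative are allowed
  because this is the shape that the product rule delivers.\<close>

lemma smooth_coinduct:
  assumes "f \<in> G"
    and G: "\<And>g. g \<in> G \<Longrightarrow>
      \<exists>g1\<in>G. \<exists>g2\<in>G. \<forall>x. (g has_vector_derivative g1 x + g2 x) (at x)"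
  shows "smooth f"
proof -
  define S where "S = {h. \<exists>gs. set gs \<subseteq> G \<and> h = (\<lambda>x. \<Sum>g\<leftarrow>gs. g x)}"
  have ex: "\<exists>hs. set hs \<subseteq> G \<and>
      (\<forall>x. ((\<lambda>x. \<Sum>g\<leftarrow>gs. g x) has_vector_derivative (\<Sum>g\<leftarrow>hs. g x)) (at x))"
    if "set gs \<subseteq> G" for gs
    using that
  proof (induction gs)
    case Nil
    show ?case by (intro exI[of _ "[]"]) auto
  next
    case (Cons g gs)
    obtain hs where hs: "set hs \<subseteq> G"
      "\<And>x. ((\<lambda>x. \<Sum>g\<leftarrow>gs. g x) has_vector_derivative (\<Sum>g\<leftarrow>hs. g x)) (at x)"
      using Cons by auto
    obtain g1 g2 where g: "g1 \<in> G" "g2 \<in> G" "\<And>x. (g has_vector_derivative g1 x + g2 x) (at x)"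
      using G[of g] Cons.prems by auto
    show ?case
    proof (intro exI[of _ "g1 # g2 # hs"] conjI allI)
      fix x
      show "((\<lambda>x. \<Sum>g\<leftarrow>g # gs. g x) has_vector_derivative (\<Sum>g\<leftarrow>g1 # g2 # hs. g x)) (at x)"
        using has_vector_derivative_add[OF g(3) hs(2), of x] by (simp add: add.assoc)
    qed (use g hs in auto)
  qed
  have step: "\<exists>h'\<in>S. \<forall>x. (h has_vector_derivative h' x) (at x)" if "h \<in> S" for h
  proof -
    obtain gs where gs: "set gs \<subseteq> G" "h = (\<lambda>x. \<Sum>g\<leftarrow>gs. g x)"
      using \<open>h \<in> S\<close> unfolding S_def by blast
    obtain hs where "set hs \<subseteq> G" "\<forall>x. (h has_vector_derivative (\<Sum>g\<leftarrow>hs. g x)) (at x)"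
      using ex[OF gs(1)] unfolding gs(2) by blast
    then show ?thesis
      unfolding S_def by (intro bexI[of _ "\<lambda>x. \<Sum>g\<leftarrow>hs. g x"] CollectI exI[of _ hs]) simp_all
  qed
  have S: "nderiv k f \<in> S" for k
  proof (induction k)
    case 0
    have "f = (\<lambda>x. \<Sum>g\<leftarrow>[f]. g x)" by simp
    with assms(1) show ?case
      unfolding S_def nderiv_0 by (intro CollectI exI[of _ "[f]"]) simp
  next
    case (Suc k)
    obtain h' where h': "h' \<in> S" "\<And>x. (nderiv k f has_vector_derivative h' x) (at x)"
      using step[OF Suc] by blast
    have "nderiv (Suc k) f = h'"
      unfolding nderiv_Suc using h'(2) by (auto intro: vector_derivative_at)
    with h'(1) show ?case by simp
  qed
  show ?thesis
    unfolding smooth_def using step[OF S] by (meson differentiableI_vector)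
qed

lemma smooth_has_vector_derivative:
  "smooth f \<Longrightarrow> (f has_vector_derivative nderiv 1 f x) (at x)"
  unfolding smooth_def by (metis nderiv_0 nderiv_Suc One_nat_def vector_derivative_works)

lemma nderiv_1_eqI:
  "(\<And>x. (f has_vector_derivative g x) (at x)) \<Longrightarrow> nderiv 1 f = g"
  by (auto simp: nderiv_Suc intro: vector_derivative_at)

lemma smooth_nderiv: "smooth f \<Longrightarrow> smooth (nderiv j f)"
  by (simp add: smooth_def nderiv_nderiv)

lemma smooth_if_deriv_smooth:
  assumes f: "\<And>x. (f has_vector_derivative g x) (at x)" and "smooth g"
  shows "smooth f"
proof -
  have g: "nderiv (Suc 0) f = g"
    using nderiv_1_eqI[OF f] by simp
  have "nderiv k f differentiable at x" for k x
  proof (cases k)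
    case 0
    then show ?thesis using f by (auto intro: differentiableI_vector)
  next
    case (Suc l)
    have "nderiv k f = nderiv l g"
      using nderiv_nderiv[of l "Suc 0" f] by (simp only: g Suc add_Suc_right add_0_right)
    then show ?thesis using assms(2) by (simp add: smooth_def)
  qed
  then show ?thesis by (simp add: smooth_def)
qed

text \<open>The products of two smooth functions form a family in which each derivative is a sum of
  two members, as coinduction asks.\<close>

lemma smooth_mult:
  assumes "smooth f" "smooth g"
  shows "smooth (\<lambda>x. f x * g x)"
proof (rule smooth_coinduct)
  let ?G = "{(\<lambda>x. f x * g x) |f g. smooth f \<and> smooth g}"
  show "(\<lambda>x. f x * g x) \<in> ?G" using assms by blast
  fix h assume "h \<in> ?G"
  then obtain f g where h: "h = (\<lambda>x. f x * g x)" and f: "smooth f" and g: "smooth g" by blast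
  show "\<exists>g1\<in>?G. \<exists>g2\<in>?G. \<forall>x. (h has_vector_derivative g1 x + g2 x) (at x)"
  proof (intro bexI)
    show "\<forall>x. (h has_vector_derivative f x * nderiv 1 g x + nderiv 1 f x * g x) (at x)"
      unfolding h using f g by (auto intro!: has_vector_derivative_mult smooth_has_vector_derivative simp del: One_nat_def)
    show "(\<lambda>x. f x * nderiv 1 g x) \<in> ?G" "(\<lambda>x. nderiv 1 f x * g x) \<in> ?G"
      using f g smooth_nderiv by blast+
  qed
qed

lemma nderiv_1_mult:
  assumes "smooth f" "smooth g"
  shows "nderiv 1 (\<lambda>x. f x * g x) = (\<lambda>x. f x * nderiv 1 g x + nderiv 1 f x * g x)"
  using assms
  by (intro nderiv_1_eqI has_vector_derivative_mult smooth_has_vector_derivative)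

lemma smooth_add:
  assumes "smooth f" "smooth g"
  shows "smooth (\<lambda>x. f x + g x)"
proof (rule smooth_coinduct)
  let ?G = "{(\<lambda>x. f x + g x) |f g. smooth f \<and> smooth g}"
  \<comment> \<open>The zero function pads each of the two summands of the derivative, so that each
    is again a sum of two smooth functions.\<close>
  have 0: "smooth (\<lambda>x. 0)"
    by (rule smooth_coinduct[of _ "{\<lambda>x. 0}"]) auto
  show "(\<lambda>x. f x + g x) \<in> ?G" using assms by blast
  fix h assume "h \<in> ?G"
  then obtain f g where h: "h = (\<lambda>x. f x + g x)" and f: "smooth f" and g: "smooth g" by blast
  show "\<exists>g1\<in>?G. \<exists>g2\<in>?G. \<forall>x. (h has_vector_derivative g1 x + g2 x) (at x)"
  proof (intro bexI)
    show "\<forall>x. (h has_vector_derivative (nderiv 1 f x + 0) + (nderiv 1 g x + 0)) (at x)"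
      unfolding h using f g by (auto intro!: has_vector_derivative_add smooth_has_vector_derivative simp del: One_nat_def)
    show "(\<lambda>x. nderiv 1 f x + 0) \<in> ?G"
      using smooth_nderiv[OF f, of 1] 0
      by (intro CollectI exI[of _ "nderiv 1 f"] exI[of _ "\<lambda>x. 0"]) (simp del: One_nat_def)
    show "(\<lambda>x. nderiv 1 g x + 0) \<in> ?G"
      using smooth_nderiv[OF g, of 1] 0
      by (intro CollectI exI[of _ "nderiv 1 g"] exI[of _ "\<lambda>x. 0"]) (simp del: One_nat_def)
  qed
qed

lemma smooth_monomial: "smooth (\<lambda>x. of_real (c * x ^ k))"
proof (rule smooth_coinduct)
  let ?G = "{(\<lambda>x. complex_of_real (c * x ^ k)) |c k. True}"
  show "(\<lambda>x. of_real (c * x ^ k)) \<in> ?G" by blast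
  fix h assume "h \<in> ?G"
  then obtain c k where h: "h = (\<lambda>x. of_real (c * x ^ k))" by blast
  show "\<exists>g1\<in>?G. \<exists>g2\<in>?G. \<forall>x. (h has_vector_derivative g1 x + g2 x) (at x)"
  proof (intro bexI allI)
    fix x :: real
    \<comment> \<open>The summand \<open>0 * x ^ 0\<close> fills the second place required by
      coinduction. For \<open>k = 0\<close> the truncated exponent is harmless because of the factor
      \<open>real k\<close>.\<close>
    have "((\<lambda>x. c * x ^ k) has_real_derivative c * (real k * x ^ (k - 1)) + 0 * x ^ 0) (at x)"
      by (auto intro!: derivative_eq_intros)
    from has_vector_derivative_of_real[OF this]
    show "(h has_vector_derivative
        of_real (c * real k * x ^ (k - 1)) + of_real (0 * x ^ 0)) (at x)"
      unfolding h by (simp add: mult.assoc)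
  qed blast+
qed

section \<open>Bump functions\<close>

text \<open>The classical flat function \<open>exp (- 1 / x)\<close>, extended by zero to the left.
  The factor \<open>(1 / x) ^ k\<close> is included so that the span of the family is closed under
  differentiation.\<close>

definition expinv :: "nat \<Rightarrow> real \<Rightarrow> real" where
  "expinv k x = (if x > 0 then (1 / x) ^ k * exp (- 1 / x) else 0)"

text \<open>After the substitution of \<open>1 / x\<close>, this is the dominance of the exponential
  over powers at infinity.\<close>

lemma expinv_tendsto_0: "((\<lambda>x. expinv k x) \<longlongrightarrow> 0) (at 0)"
proof -
  have "(expinv k \<longlongrightarrow> 0) (at_left 0)"
    by (rule tendsto_eventually)
      (auto simp: expinv_def eventually_at_left_field intro!: exI[of _ "-1"])
  moreover have "(expinv k \<longlongrightarrow> 0) (at_right 0)"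
  proof -
    have "((\<lambda>x::real. inverse x ^ k / exp (inverse x)) \<longlongrightarrow> 0) (at_right 0)"
      by (rule filterlim_compose[OF tendsto_power_div_exp_0 filterlim_inverse_at_top_right])
    moreover have "\<forall>\<^sub>F x::real in at_right 0. inverse x ^ k / exp (inverse x) = expinv k x"
      by (auto simp: expinv_def eventually_at_right_field exp_minus field_simps power_divide intro!: exI[of _ 1])
    ultimately show ?thesis by (rule Lim_transform_eventually)
  qed
  ultimately show ?thesis by (simp add: filterlim_split_at)
qed

lemma expinv_has_derivative:
  "(expinv k has_real_derivative (- real k * expinv (k + 1) x + expinv (k + 2) x)) (at x)"
proof (cases x "0::real" rule: linorder_cases)
  case less
  have "(expinv k has_real_derivative 0) (at x)"
    by (rule has_field_derivative_transform_within_open[of "\<lambda>_. 0" _ _ "{..<0}"])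
      (use less in \<open>auto simp: expinv_def\<close>)
  then show ?thesis using less by (simp add: expinv_def)
next
  case equal
  have "((\<lambda>h. expinv (k + 1) h) \<longlongrightarrow> 0) (at 0)" by (rule expinv_tendsto_0)
  \<comment> \<open>The difference quotient at 0 is itself the next member of the family, so its
    limit is already known.\<close>
  moreover have "expinv (k + 1) h = (expinv k (0 + h) - expinv k 0) / h" for h
    by (auto simp: expinv_def)
  ultimately have "(expinv k has_real_derivative 0) (at 0)"
    unfolding has_field_derivative_def DERIV_def[unfolded has_field_derivative_def] by simp
  then show ?thesis using equal by (simp add: expinv_def)
next
  case greater
  have "((\<lambda>x. (1 / x) ^ k * exp (- 1 / x)) has_real_derivative
      (- real k * expinv (k + 1) x + expinv (k + 2) x)) (at x)"
  proof -
    have "((\<lambda>x. (1 / x) ^ k) has_real_derivative - real k * (1 / x) ^ (k + 1)) (at x)"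
    proof (cases k)
      case (Suc l)
      have "((\<lambda>x. 1 / x) has_real_derivative - ((1 / x) ^ 2)) (at x)"
        using greater by (auto intro!: derivative_eq_intros simp: power2_eq_square)
      from DERIV_power[OF this, of k] show ?thesis
        by (rule DERIV_cong) (use greater in \<open>simp add: Suc power2_eq_square field_simps\<close>)
    qed simp
    moreover have "((\<lambda>x. exp (- 1 / x)) has_real_derivative (1 / x) ^ 2 * exp (- 1 / x)) (at x)"
      using greater by (auto intro!: derivative_eq_intros simp: power2_eq_square)
    ultimately show ?thesis
      using DERIV_mult[of "\<lambda>x. (1 / x) ^ k" "- real k * (1 / x) ^ (k + 1)" x UNIV
        "\<lambda>x. exp (- 1 / x)" "(1 / x) ^ 2 * exp (- 1 / x)"] greater
      by (simp add: expinv_def power_add mult_ac power2_eq_square)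
  qed
  then show ?thesis
    by (rule has_field_derivative_transform_within_open[of _ _ _ "{0<..}"])
      (use greater in \<open>auto simp: expinv_def\<close>)
qed

lemma smooth_expinv: "smooth (\<lambda>x. of_real (expinv 0 (a * x + b)))"
proof (rule smooth_coinduct)
  let ?G = "{(\<lambda>x. complex_of_real (c * expinv k (a * x + b))) |c k. True}"
  have "(\<lambda>x. of_real (1 * expinv 0 (a * x + b))) \<in> ?G" by blast
  then show "(\<lambda>x. of_real (expinv 0 (a * x + b))) \<in> ?G" by simp
  fix h assume "h \<in> ?G"
  then obtain c k where h: "h = (\<lambda>x. of_real (c * expinv k (a * x + b)))" by blast
  show "\<exists>g1\<in>?G. \<exists>g2\<in>?G. \<forall>x. (h has_vector_derivative g1 x + g2 x) (at x)"
  proof (intro bexI allI)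
    fix x :: real
    have "((\<lambda>x. a * x + b) has_real_derivative a) (at x)"
      by (auto intro!: derivative_eq_intros)
    from DERIV_chain2[OF expinv_has_derivative this]
    have "((\<lambda>x. expinv k (a * x + b)) has_real_derivative
        (- real k * expinv (k + 1) (a * x + b) + expinv (k + 2) (a * x + b)) * a) (at x)" .
    from has_vector_derivative_of_real[OF DERIV_cmult[OF this, of c]]
    have "(h has_vector_derivative of_real (c *
        ((- real k * expinv (k + 1) (a * x + b) + expinv (k + 2) (a * x + b)) * a))) (at x)"
      unfolding h .
    also have "of_real (c *
        ((- real k * expinv (k + 1) (a * x + b) + expinv (k + 2) (a * x + b)) * a)) =
        complex_of_real ((- real k * a * c) * expinv (k + 1) (a * x + b)) +
        of_real ((a * c) * expinv (k + 2) (a * x + b))"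
      by (simp add: algebra_simps)
    finally show "(h has_vector_derivative
        of_real ((- real k * a * c) * expinv (k + 1) (a * x + b)) +
        of_real ((a * c) * expinv (k + 2) (a * x + b))) (at x)" .
  qed blast+
qed

text \<open>The two flat factors cut off on the left of \<open>a\<close> and on the right of
  \<open>b\<close>. As the scale \<open>n\<close> grows, both factors tend to 1 inside the interval,
  so indicators are limits of bumps.\<close>

definition bump :: "real \<Rightarrow> real \<Rightarrow> real \<Rightarrow> real \<Rightarrow> complex" where
  "bump n a b x = of_real (expinv 0 (n * (x - a))) * of_real (expinv 0 (n * (b - x)))"

lemma bump_test_fun:
  assumes "0 < a" "b < 1" "0 < n"
  shows "bump n a b \<in> test_funs"
proof (rule test_funsI[OF _ assms(1,2)])
  have "smooth (bump n a b)"
    unfolding bump_def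
    using smooth_mult[OF smooth_expinv[of n "- n * a"] smooth_expinv[of "- n" "n * b"]]
    by (simp add: algebra_simps)
  then show "nderiv k (bump n a b) differentiable at x" for k x
    by (simp add: smooth_def)
  show "bump n a b x = 0" if "x \<notin> {a..b}" for x
    using that \<open>0 < n\<close> by (auto simp: bump_def expinv_def zero_less_mult_iff)
qed

lemma bump_le_1: "0 < n \<Longrightarrow> norm (bump n a b x) \<le> 1"
proof -
  have "expinv 0 y \<ge> 0" "expinv 0 y \<le> 1" for y by (auto simp: expinv_def)
  then show ?thesis by (simp add: bump_def norm_mult mult_le_one)
qed

lemma bump_tendsto: "(\<lambda>n. bump (real (Suc n)) a b x) \<longlonglongrightarrow> indicator {a<..<b} x"
proof (cases "a < x \<and> x < b")
  case False
  then have "bump (real (Suc n)) a b x = 0" for n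
    by (auto simp: bump_def expinv_def zero_less_mult_iff)
  with False show ?thesis by simp
next
  case True
  have *: "(\<lambda>n. expinv 0 (real (Suc n) * y)) \<longlonglongrightarrow> 1" if "y > 0" for y
  proof -
    have "(\<lambda>n. exp (- (1 / real (Suc n) * (1 / y)))) \<longlonglongrightarrow> exp (- (0 * (1 / y)))"
      by (intro tendsto_intros LIMSEQ_Suc[OF lim_1_over_n])
    then show ?thesis using that by (simp add: expinv_def)
  qed
  have "(\<lambda>n. bump (real (Suc n)) a b x) \<longlonglongrightarrow> of_real 1 * of_real 1"
    unfolding bump_def using True by (intro tendsto_mult tendsto_of_real *) auto
  with True show ?thesis by simp
qed

section \<open>Smooth functions as multipliers and integration by parts against test
  functions\<close>

lemma smooth_test_fun: "z \<in> test_funs \<Longrightarrow> smooth z"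
  by (simp add: smooth_def test_funs_differentiable)

lemma test_funs_smooth_mult:
  assumes "smooth f" "z \<in> test_funs"
  shows "(\<lambda>x. f x * z x) \<in> test_funs"
proof -
  obtain a b where ab: "0 < a" "b < 1" "\<And>x. x \<notin> {a..b} \<Longrightarrow> z x = 0"
    using test_funs_support[OF assms(2)] by blast
  have "smooth (\<lambda>x. f x * z x)"
    using assms smooth_mult smooth_test_fun by blast
  then show ?thesis
    by (intro test_funsI[OF _ ab(1,2)]) (simp_all add: smooth_def ab(3) del: atLeastAtMost_iff)
qed

lemma test_funs_nderiv_pow: "z \<in> test_funs \<Longrightarrow> nderiv k z \<in> test_funs"
proof (induction k)
  case (Suc k)
  then show ?case using test_funs_nderiv[of "nderiv k z"] nderiv_nderiv[of 1 k z] by simp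
qed simp

lemma smooth_continuous: "smooth f \<Longrightarrow> continuous_on UNIV f"
  using smooth_has_vector_derivative
  by (metis continuous_at_imp_continuous_on has_vector_derivative_continuous)

lemma continuous_integrable_I01:
  "continuous_on {0..1} f \<Longrightarrow> integrable I01 (f :: real \<Rightarrow> complex)"
  by (rule continuous_imp_integrable_real)

lemma smooth_Lp_1: "smooth f \<Longrightarrow> f \<in> Lp 1"
  by (meson Lp_1_integrable continuous_integrable_I01 continuous_on_subset smooth_continuous top_greatest)

text \<open>By the fundamental theorem of calculus the integral is the difference of the boundary
  values, and both vanish because the support lies inside the open interval.\<close>

lemma LINT_nderiv_eq_0:
  assumes z: "z \<in> test_funs"
  shows "(LINT x|I01. nderiv 1 z x) = 0"
proof -
  obtain a b where ab: "0 < a" "b < 1" "\<And>x. x \<notin> {a..b} \<Longrightarrow> z x = 0"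
    using test_funs_support[OF z] by blast
  have "(nderiv 1 z has_integral z 1 - z 0) {0..1}"
    by (rule fundamental_theorem_of_calculus)
      (auto intro: has_vector_derivative_at_within smooth_has_vector_derivative smooth_test_fun z simp del: One_nat_def)
  moreover have "integrable I01 (nderiv 1 z)"
    using smooth_Lp_1[OF smooth_test_fun[OF test_funs_nderiv[OF z]]] Lp_1_integrable by blast
  ultimately show ?thesis
    using ab by (simp add: lebesgue_integral_eq_integral integral_unique)
qed

text \<open>The product of \<open>q\<close> and \<open>z\<close> is a test function, so the integral
  of its derivative vanishes.\<close>

lemma LINT_smooth_nderiv:
  assumes q: "smooth q" and z: "z \<in> test_funs"
  shows "(LINT x|I01. q x * nderiv 1 z x) = - (LINT x|I01. nderiv 1 q x * z x)"
proof -
  have "(LINT x|I01. q x * nderiv 1 z x + nderiv 1 q x * z x) = 0"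
    using LINT_nderiv_eq_0[OF test_funs_smooth_mult[OF q z]]
    by (simp only: nderiv_1_mult[OF q smooth_test_fun[OF z]])
  moreover have "integrable I01 (\<lambda>x. q x * nderiv 1 z x)" "integrable I01 (\<lambda>x. nderiv 1 q x * z x)"
    using q z by (auto intro!: integrable_mult_test_fun smooth_Lp_1 test_funs_nderiv smooth_nderiv simp del: One_nat_def)
  ultimately show ?thesis
    by (simp add: eq_neg_iff_add_eq_0 del: One_nat_def)
qed

lemma reg_apply: "z \<in> test_funs \<Longrightarrow> reg f z = (LINT x|I01. f x * z x)"
  by (simp add: reg_def)

lemma dderiv_apply: "z \<in> test_funs \<Longrightarrow> dderiv T z = - T (nderiv 1 z)"
  by (simp add: dderiv_def)

lemma dderiv_pow_apply:
  "z \<in> test_funs \<Longrightarrow> (dderiv ^^ i) T z = (-1) ^ i * T (nderiv i z)"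
proof (induction i arbitrary: z)
  case (Suc i)
  have "(dderiv ^^ Suc i) T z = - (dderiv ^^ i) T (nderiv 1 z)"
    using Suc.prems by (simp add: dderiv_apply del: One_nat_def)
  also have "\<dots> = (-1) ^ Suc i * T (nderiv (i + 1) z)"
    using Suc.IH[OF test_funs_nderiv[OF Suc.prems]] by (simp only: nderiv_nderiv) simp
  finally show ?case by simp
qed simp

lemma extensional_reg: "reg f \<in> extensional test_funs"
  by (simp add: reg_def)

lemma extensional_dderiv: "dderiv T \<in> extensional test_funs"
  by (simp add: dderiv_def)

lemma functional_eqI:
  assumes "S \<in> extensional test_funs" "T \<in> extensional test_funs"
    "\<And>z. z \<in> test_funs \<Longrightarrow> S z = T z"
  shows "S = T"
  using assms by (rule extensionalityI)

lemma dderiv_reg_smooth: "smooth q \<Longrightarrow> dderiv (reg q) = reg (nderiv 1 q)"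
  by (intro functional_eqI extensional_dderiv extensional_reg)
    (simp add: dderiv_apply reg_apply test_funs_nderiv LINT_smooth_nderiv del: One_nat_def)

lemma dderiv_pow_reg_smooth: "smooth q \<Longrightarrow> (dderiv ^^ i) (reg q) = reg (nderiv i q)"
proof (induction i)
  case (Suc i)
  then show ?case
    using dderiv_reg_smooth[OF smooth_nderiv[OF Suc.prems, of i]] nderiv_nderiv[of 1 i q] by simp
qed simp

section \<open>The fundamental lemma and the du Bois-Reymond lemma\<close>

lemma borel_eq_open_intervals: "borel = sigma UNIV (range (\<lambda>(a, b). {a<..<b :: real}))"
  using borel_eq_box[where 'a = real] by (simp add: box_real)

lemma sigma_finite_lebesgue: "sigma_finite_measure (lebesgue :: 'a::euclidean_space measure)"
proof -
  obtain A :: "'a set set" where "countable A" "A \<subseteq> sets lborel" "\<Union> A = space lborel"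
      "\<forall>a\<in>A. emeasure lborel a \<noteq> \<infinity>"
    using lborel.sigma_finite_countable by blast
  then show ?thesis
    by (intro sigma_finite_measure.intro exI[of _ A])
      (auto simp: emeasure_completion subset_eq)
qed

text \<open>A Dynkin argument: open intervals are closed under intersection and generate the Borel
  sets, and the vanishing of the integral passes to complements and countable disjoint unions. A
  Lebesgue set differs from a Borel set by a null set.\<close>

lemma AE_zero_if_intervals:
  fixes f :: "real \<Rightarrow> complex"
  assumes f: "integrable lebesgue f"
    and 0: "\<And>a b. (LINT x:{a<..<b}|lebesgue. f x) = 0"
  shows "AE x in lebesgue. f x = 0"
proof (rule sigma_finite_measure.density_zero[OF sigma_finite_lebesgue f])
  fix A :: "real set" assume "A \<in> sets lebesgue"
  then obtain S N N' where A: "A = S \<union> N" "N \<subseteq> N'" "N' \<in> null_sets lborel" "S \<in> sets lborel"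
    by (rule sets_completionE)
  have si: "set_integrable lebesgue B f" if "B \<in> sets borel" for B
    unfolding set_integrable_def using f that by (intro integrable_mult_indicator) auto
  \<comment> \<open>The integral over the whole line is needed for complements. It is the limit of
    the integrals over growing bounded intervals.\<close>
  have all: "(LINT x|lebesgue. f x) = 0"
  proof -
    have "(\<lambda>n. LINT x|lebesgue. indicat_real {- real n<..<real n} x *\<^sub>R f x) \<longlonglongrightarrow> (LINT x|lebesgue. f x)"
    proof (rule integral_dominated_convergence[where w = "\<lambda>x. norm (f x)"])
      show "AE x in lebesgue. (\<lambda>n. indicat_real {- real n<..<real n} x *\<^sub>R f x) \<longlonglongrightarrow> f x"
      proof (rule AE_I2)
        fix x :: real
        obtain N where N: "real N > \<bar>x\<bar>" using reals_Archimedean2 by blast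
        have "\<forall>\<^sub>F n in sequentially. f x = indicat_real {- real n<..<real n} x *\<^sub>R f x"
          using eventually_ge_at_top[of N] by eventually_elim (use N in \<open>auto simp: indicator_def\<close>)
        then show "(\<lambda>n. indicat_real {- real n<..<real n} x *\<^sub>R f x) \<longlonglongrightarrow> f x"
          by (rule Lim_transform_eventually[OF tendsto_const])
      qed
      show "(\<lambda>x. indicat_real {- real n<..<real n} x *\<^sub>R f x) \<in> borel_measurable lebesgue" for n
        by (rule borel_measurable_integrable, rule integrable_mult_indicator[OF _ f]) simp
    qed (use f in \<open>auto simp: indicator_def\<close>)
    then show ?thesis using 0 by (simp add: set_lebesgue_integral_def LIMSEQ_const_iff)
  qed
  have S: "S \<in> sigma_sets UNIV (range (\<lambda>(a, b). {a <..< b :: real}))"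
    using A(4) unfolding sets_lborel by (subst (asm) borel_eq_open_intervals) simp
  have "Int_stable (range (\<lambda>(a, b). {a <..< b :: real}))"
  proof (rule Int_stableI)
    fix B C assume "B \<in> range (\<lambda>(a, b). {a <..< b :: real})" "C \<in> range (\<lambda>(a, b). {a <..< b :: real})"
    then obtain a b c d where "B = {a<..<b}" "C = {c<..<d}" by auto
    then have "B \<inter> C = (\<lambda>(a, b). {a<..<b}) (max a c, min b d)" by auto
    then show "B \<inter> C \<in> range (\<lambda>(a, b). {a <..< b :: real})" by blast
  qed
  moreover have "range (\<lambda>(a, b). {a <..< b :: real}) \<subseteq> Pow UNIV" by simp
  ultimately have "(LINT x:S|lebesgue. f x) = 0"
    using S
  proof (induction rule: sigma_sets_induct_disjoint)
    case (compl B)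
    have "B \<in> sets borel"
      using compl(1) by (subst borel_eq_open_intervals) simp
    then have "integrable lebesgue (\<lambda>x. indicat_real B x *\<^sub>R f x)"
      using si by (simp add: set_integrable_def)
    moreover have "indicat_real (UNIV - B) x *\<^sub>R f x = f x - indicat_real B x *\<^sub>R f x" for x
      by (simp add: indicator_def)
    ultimately show ?case
      using compl(2) all f by (simp add: set_lebesgue_integral_def)
  next
    case (union B)
    have B: "B i \<in> sets borel" for i
      using union(2) by (subst borel_eq_open_intervals) auto
    have "(LINT x:(\<Union>i. B i)|lebesgue. f x) = (\<Sum>i. (LINT x:(B i)|lebesgue. f x))"
      using B union(1)
      by (intro lebesgue_integral_countable_add si) (auto simp: disjoint_family_on_def)
    then show ?case using union(3) by simp
  next
    case (basic B)
    then show ?case using 0 by auto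
  qed (simp add: set_lebesgue_integral_def)
  moreover have "(LINT x:A|lebesgue. f x) = (LINT x:S|lebesgue. f x)"
  proof (rule set_integral_cong_set)
    have "AE x in lebesgue. x \<notin> N'"
      using A(3) by (intro AE_not_in) (simp add: null_sets_completionI)
    then show "AE x in lebesgue. (x \<in> S) = (x \<in> A)"
      by eventually_elim (use A(1,2) in auto)
    show "set_borel_measurable lebesgue A f" "set_borel_measurable lebesgue S f"
      unfolding set_borel_measurable_def using A(4) \<open>A \<in> sets lebesgue\<close>
      by (intro borel_measurable_integrable integrable_mult_indicator f; simp)+
  qed
  ultimately show "(LINT x:A|lebesgue. f x) = 0" by simp
qed

text \<open>Bumps approximate the indicator of an interval, so by dominated convergence
  \<open>f\<close> integrates to zero over intervals inside the open unit interval, and then over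
  all intervals after extension by zero.\<close>

lemma fundamental_lemma:
  assumes f: "f \<in> Lp 1" and 0: "\<And>z. z \<in> test_funs \<Longrightarrow> (LINT x|I01. f x * z x) = 0"
  shows "AE x in I01. f x = 0"
proof -
  have fi: "integrable I01 f" using f Lp_1_integrable by blast
  have fm: "f \<in> borel_measurable I01" using fi by auto
  have inner: "(LINT x|I01. f x * indicator {a<..<b} x) = 0" if ab: "0 < a" "b < 1" for a b
  proof -
    have "(\<lambda>n. LINT x|I01. f x * bump (real (Suc n)) a b x) \<longlonglongrightarrow> (LINT x|I01. f x * indicator {a<..<b} x)"
    proof (rule integral_dominated_convergence[where w = "\<lambda>x. norm (f x)"])
      show "AE x in I01. (\<lambda>n. f x * bump (real (Suc n)) a b x) \<longlonglongrightarrow> f x * indicator {a<..<b} x"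
        by (intro AE_I2 tendsto_mult tendsto_const bump_tendsto)
      show "AE x in I01. norm (f x * bump (real (Suc n)) a b x) \<le> norm (f x)" for n
        using bump_le_1[of "real (Suc n)" a b]
        by (intro AE_I2) (auto simp: norm_mult intro!: mult_left_le)
      show "(\<lambda>x. f x * bump (real (Suc n)) a b x) \<in> borel_measurable I01" for n
        using integrable_mult_test_fun[OF f bump_test_fun[OF ab, of "real (Suc n)"]] by auto
      show "(\<lambda>x. f x * indicator {a<..<b} x) \<in> borel_measurable I01"
        by (intro borel_measurable_times fm measurable_restrict_space1 borel_measurable_indicator) auto
    qed (use fi in auto)
    moreover have "(LINT x|I01. f x * bump (real (Suc n)) a b x) = 0" for n
      using 0 bump_test_fun[OF ab, of "real (Suc n)"] by simp
    ultimately show ?thesis by (simp add: LIMSEQ_const_iff)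
  qed
  define g where "g x = indicat_real {0..1} x *\<^sub>R f x" for x
  have g: "integrable lebesgue g"
    using fi by (simp add: g_def[abs_def] integrable_restrict_space)
  have "(LINT x:{a<..<b}|lebesgue. g x) = 0" for a b
  proof -
    \<comment> \<open>The ends are pushed strictly inside the unit interval, where the bumps are
      test functions. The shift by \<open>1 / real (Suc n)\<close> disappears in the limit.\<close>
    define \<alpha> \<beta> where "\<alpha> n = max a (1 / real (Suc n))" and "\<beta> n = min b (1 - 1 / real (Suc n))" for n
    have "(\<lambda>n. LINT x:{\<alpha> n<..<\<beta> n}|lebesgue. g x) \<longlonglongrightarrow> (LINT x:{a<..<b}|lebesgue. g x)"
      unfolding set_lebesgue_integral_def
    proof (rule integral_dominated_convergence[where w = "\<lambda>x. norm (g x)"])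
      \<comment> \<open>The truncated intervals never contain the endpoints 0 and 1, although
        \<open>g\<close> may be nonzero there.\<close>
      have "AE x in lebesgue. x \<notin> {0, 1::real}"
        by (intro AE_not_in) (auto intro!: null_sets_completionI countable_imp_null_set_lborel)
      then show "AE x in lebesgue. (\<lambda>n. indicat_real {\<alpha> n<..<\<beta> n} x *\<^sub>R g x) \<longlonglongrightarrow> indicat_real {a<..<b} x *\<^sub>R g x"
      proof eventually_elim
        case (elim x)
        show ?case
        proof (cases "0 < x \<and> x < 1")
          case False
          then have "g x = 0" using elim by (auto simp: g_def)
          then show ?thesis by simp
        next
          case True
          have "\<forall>\<^sub>F n in sequentially. 1 / real (Suc n) < min x (1 - x)"
            using order_tendstoD(2)[OF LIMSEQ_Suc[OF lim_1_over_n], of "min x (1 - x)"] True by simp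
          then have "\<forall>\<^sub>F n in sequentially. indicat_real {a<..<b} x *\<^sub>R g x = indicat_real {\<alpha> n<..<\<beta> n} x *\<^sub>R g x"
            by eventually_elim (auto simp: \<alpha>_def \<beta>_def indicator_def)
          then show ?thesis by (rule Lim_transform_eventually[OF tendsto_const])
        qed
      qed
      show "(\<lambda>x. indicat_real {\<alpha> n<..<\<beta> n} x *\<^sub>R g x) \<in> borel_measurable lebesgue" for n
        by (rule borel_measurable_integrable, rule integrable_mult_indicator[OF _ g]) simp
      show "(\<lambda>x. indicat_real {a<..<b} x *\<^sub>R g x) \<in> borel_measurable lebesgue"
        by (rule borel_measurable_integrable, rule integrable_mult_indicator[OF _ g]) simp
    qed (use g in \<open>auto simp: indicator_def\<close>)
    moreover have "(LINT x:{\<alpha> n<..<\<beta> n}|lebesgue. g x) = 0" for n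
    proof -
      have ab: "0 < \<alpha> n" "\<beta> n < 1"
        unfolding \<alpha>_def \<beta>_def by (auto simp: less_max_iff_disj min_less_iff_disj)
      have "(LINT x:{\<alpha> n<..<\<beta> n}|lebesgue. g x) = (LINT x|lebesgue. indicat_real {0..1} x *\<^sub>R (f x * indicator {\<alpha> n<..<\<beta> n} x))"
        unfolding set_lebesgue_integral_def by (rule Bochner_Integration.integral_cong) (auto simp: g_def indicator_def)
      also have "\<dots> = (LINT x|I01. f x * indicator {\<alpha> n<..<\<beta> n} x)"
        by (rule integral_restrict_space[symmetric]) simp
      finally show ?thesis using inner[OF ab] by simp
    qed
    ultimately show ?thesis by (simp add: LIMSEQ_const_iff)
  qed
  from AE_zero_if_intervals[OF g this] show ?thesis
    by (subst AE_restrict_space_iff) (auto simp: g_def elim!: eventually_mono)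
qed

lemma Lp_1_diff: "f \<in> Lp 1 \<Longrightarrow> g \<in> Lp 1 \<Longrightarrow> (\<lambda>x. f x - g x) \<in> Lp 1"
  unfolding Lp_1_integrable by simp

lemma reg_eq_AE:
  assumes "f \<in> Lp 1" "g \<in> Lp 1" "reg f = reg g"
  shows "AE x in I01. f x = g x"
proof -
  have "AE x in I01. f x - g x = 0"
  proof (rule fundamental_lemma[OF Lp_1_diff[OF assms(1,2)]])
    fix z assume z: "z \<in> test_funs"
    then show "(LINT x|I01. (f x - g x) * z x) = 0"
      using fun_cong[OF assms(3), of z] assms(1,2)
      by (simp add: reg_apply left_diff_distrib integrable_mult_test_fun)
  qed
  then show ?thesis by simp
qed

lemma reg_cong_AE:
  assumes "f \<in> Lp 1" "g \<in> Lp 1" "AE x in I01. f x = g x"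
  shows "reg f = reg g"
proof (rule functional_eqI[OF extensional_reg extensional_reg])
  fix z assume z: "z \<in> test_funs"
  show "reg f z = reg g z"
    unfolding reg_apply[OF z]
    using integrable_mult_test_fun[OF assms(1) z] integrable_mult_test_fun[OF assms(2) z] assms(3)
    by (intro integral_cong_AE) auto
qed

text \<open>The integral from 0 vanishes to the left of the support. To the right of it, it equals
  the total integral, so the zero mean makes it compactly supported again.\<close>

lemma test_fun_antiderivative:
  assumes z: "z \<in> test_funs" and 0: "(LINT x|I01. z x) = 0"
  shows "\<exists>w\<in>test_funs. nderiv 1 w = z"
proof -
  obtain a b where ab: "0 < a" "b < 1" "\<And>x. x \<notin> {a..b} \<Longrightarrow> z x = 0"
    using test_funs_support[OF z] by blast
  define w where "w x = integral {0..x} z" for x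
  have cont: "continuous_on S z" for S
    using test_funs_continuous[OF z] continuous_on_subset by blast
  have w0: "w x = 0" if "x < a" for x
  proof -
    have "w x = integral {0..x} (\<lambda>_. 0)"
      unfolding w_def using that ab(3) by (intro Henstock_Kurzweil_Integration.integral_cong) auto
    then show ?thesis by simp
  qed
  have w: "(w has_vector_derivative z x) (at x)" for x
  proof (cases "x < a")
    case True
    have "(w has_vector_derivative 0) (at x)"
      by (rule has_vector_derivative_transform_within_open[of "\<lambda>_. 0" _ _ "{..<a}"])
        (use True w0 in auto)
    moreover have "z x = 0" using ab(3)[of x] True by auto
    ultimately show ?thesis by simp
  next
    case False
    \<comment> \<open>Here \<open>x\<close> is at least \<open>a\<close> and hence positive, so it
      is interior to \<open>{0..x+1}\<close> and the one-sided formula becomes a derivative on the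
      line.\<close>
    have "(w has_vector_derivative z x) (at x within {0..x+1})"
      unfolding w_def using False ab by (intro integral_has_vector_derivative cont) auto
    then have "(w has_vector_derivative z x) (at x within {0<..<x+1})"
      by (rule has_vector_derivative_within_subset) auto
    then show ?thesis
      using False ab(1) at_within_open[of x "{0<..<x+1}"] by simp
  qed
  have zi: "integrable I01 z"
    using smooth_Lp_1[OF smooth_test_fun[OF z]] Lp_1_integrable by blast
  have w1: "w x = 0" if "x > b" for x
  proof -
    \<comment> \<open>Both \<open>{0..x}\<close> and \<open>{0..1}\<close> exceed
      \<open>{0..b}\<close> only where \<open>z\<close> vanishes, whether or not \<open>x\<close> is
      beyond 1.\<close>
    have "z y = 0" if "y \<in> {0..x} - {0..b} \<union> ({0..1} - {0..b})" for y
      using ab(3)[of y] that by auto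
    moreover have "integral {0..c} z = integral {0..b} z" if "c \<ge> b" "\<And>y. y \<in> {0..c} - {0..b} \<Longrightarrow> z y = 0" for c
      using that by (intro integral_spike_set) (auto intro: empty_imp_negligible)
    ultimately have "w x = integral {0..1} z"
      unfolding w_def using that ab by (metis Un_iff less_imp_le)
    then show ?thesis
      using 0 zi by (simp add: lebesgue_integral_eq_integral)
  qed
  have "smooth w" by (rule smooth_if_deriv_smooth[OF w smooth_test_fun[OF z]])
  then have "w \<in> test_funs"
    by (intro test_funsI[OF _ ab(1,2)]) (use w0 w1 in \<open>auto simp: smooth_def\<close>)
  moreover have "nderiv 1 w = z" by (rule nderiv_1_eqI[OF w])
  ultimately show ?thesis by blast
qed

text \<open>Subtracting from \<open>z\<close> the multiple of a fixed \<open>h\<close> that has the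
  same integral leaves a test function of mean zero, which is a derivative and so is annihilated by
  \<open>T\<close>. Hence \<open>T z\<close> is proportional to the integral of
  \<open>z\<close>.\<close>

lemma du_Bois_Reymond:
  assumes T: "T \<in> distributions" and 0: "\<And>z. z \<in> test_funs \<Longrightarrow> T (nderiv 1 z) = 0"
  shows "\<exists>c. T = reg (\<lambda>_. c)"
proof -
  have c1: "(\<lambda>_. c) \<in> Lp 1" for c unfolding Lp_1_integrable by simp
  \<comment> \<open>If every test function had mean zero, the fundamental lemma would make the
    constant 1 vanish almost everywhere.\<close>
  obtain h where h: "h \<in> test_funs" "(LINT x|I01. h x) \<noteq> 0"
  proof (rule ccontr)
    assume "\<not> thesis"
    then have "\<And>z. z \<in> test_funs \<Longrightarrow> (LINT x|I01. 1 * z x) = 0" using that by auto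
    from fundamental_lemma[OF c1 this] have "AE x in I01. False" by simp
    then show False by (simp add: eventually_False ae_filter_eq_bot_iff emeasure_restrict_space)
  qed
  define c where "c = T h / (LINT x|I01. h x)"
  have add: "T (\<lambda>x. z x + w x) = T z + T w" if "z \<in> test_funs" "w \<in> test_funs" for z w
    using T that by (simp add: distributions_def)
  have mult: "T (\<lambda>x. d * z x) = d * T z" if "z \<in> test_funs" for z d
    using T that by (simp add: distributions_def)
  have "T = reg (\<lambda>_. c)"
  proof (rule functional_eqI[OF _ extensional_reg])
    show "T \<in> extensional test_funs" using T by (simp add: distributions_def)
    fix z assume z: "z \<in> test_funs"
    define d where "d = - (LINT x|I01. z x) / (LINT x|I01. h x)"
    have i: "integrable I01 v" if "v \<in> test_funs" for v
      using smooth_Lp_1[OF smooth_test_fun[OF that]] Lp_1_integrable by blast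
    have "(\<lambda>x. z x + d * h x) \<in> test_funs"
      by (intro test_funs_add test_funs_mult z h)
    moreover have "(LINT x|I01. z x + d * h x) = 0"
      using i[OF z] i[OF h(1)] h(2) by (simp add: d_def)
    ultimately obtain w where w: "w \<in> test_funs" "nderiv 1 w = (\<lambda>x. z x + d * h x)"
      using test_fun_antiderivative by blast
    have "T z + d * T h = 0"
      using 0[OF w(1)] unfolding w(2) by (simp add: add mult z h test_funs_mult)
    then have "T z = - d * T h" by (simp add: add_eq_0_iff)
    also have "\<dots> = (LINT x|I01. c * z x)" by (simp add: d_def c_def)
    finally show "T z = reg (\<lambda>_. c) z" using z by (simp add: reg_apply)
  qed
  then show ?thesis by blast
qed

lemma dderiv_pow_reg_in_distributions: "f \<in> Lp 1 \<Longrightarrow> (dderiv ^^ i) (reg f) \<in> distributions"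
  by (induction i) (auto simp: reg_in_distributions dderiv_in_distributions)

text \<open>Provides a smooth function whose derivative of order \<open>i\<close> is a prescribed
  constant.\<close>

lemma nderiv_monomial:
  "nderiv i (\<lambda>x. c * of_real (x ^ i / fact i)) = (\<lambda>_. c)"
proof (induction i)
  case (Suc i)
  have "nderiv 1 (\<lambda>x. c * complex_of_real (x ^ Suc i / fact (Suc i))) = (\<lambda>x. c * of_real (x ^ i / fact i))"
  proof (rule nderiv_1_eqI)
    fix x :: real
    have "((\<lambda>x. x ^ Suc i / fact (Suc i)) has_real_derivative (x ^ i / fact i)) (at x)"
      using DERIV_cdivide[OF DERIV_pow[of "Suc i" x], of "fact (Suc i)"]
      by (simp add: divide_simps del: of_nat_Suc)
    then show "((\<lambda>x. c * complex_of_real (x ^ Suc i / fact (Suc i))) has_vector_derivative c * of_real (x ^ i / fact i)) (at x)"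
      by (intro has_vector_derivative_mult_right has_vector_derivative_of_real)
  qed
  then show ?case
    using Suc nderiv_nderiv[of i 1 "\<lambda>x. c * complex_of_real (x ^ Suc i / fact (Suc i))"]
    by (simp del: fact_Suc power_Suc of_real_divide)
qed simp

lemma nderiv_smooth_add:
  assumes "smooth f" "smooth g"
  shows "nderiv k (\<lambda>x. f x + g x) = (\<lambda>x. nderiv k f x + nderiv k g x)"
proof (induction k)
  case (Suc k)
  show ?case
    unfolding nderiv_Suc Suc using assms
    by (intro ext vector_derivative_add_at) (auto simp: smooth_def)
qed simp

lemma nderiv_zero: "nderiv k (\<lambda>_. 0) = (\<lambda>_. 0)"
  by (induction k) (auto simp: nderiv_Suc)

lemma smooth_const: "smooth (\<lambda>_. c)"
proof (rule smooth_coinduct)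
  show "(\<lambda>_. c) \<in> range (\<lambda>c _. c)" by blast
  fix g :: "real \<Rightarrow> complex" assume "g \<in> range (\<lambda>c _. c)"
  then show "\<exists>g1\<in>range (\<lambda>c _. c). \<exists>g2\<in>range (\<lambda>c _. c). \<forall>x. (g has_vector_derivative g1 x + g2 x) (at x)"
    by (intro bexI[of _ "\<lambda>_. 0"]) auto
qed

text \<open>The function \<open>p\<close> stands for a polynomial of degree less than
  \<open>i\<close>, encoded by the vanishing of its derivative of order \<open>i\<close>. In the
  induction step the derivative of order \<open>i\<close> of \<open>f\<close> is a constant by du
  Bois-Reymond, and subtracting a monomial with that derivative reduces to the induction
  hypothesis.\<close>

lemma dderiv_pow_reg_eq_0:
  assumes "f \<in> Lp 1" and "\<And>z. z \<in> test_funs \<Longrightarrow> (dderiv ^^ i) (reg f) z = 0"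
  shows "\<exists>p. smooth p \<and> nderiv i p = (\<lambda>_. 0) \<and> (AE x in I01. f x = p x)"
  using assms
proof (induction i arbitrary: f)
  case 0
  have "smooth (\<lambda>_. 0)" using smooth_monomial[of 0 0] by simp
  moreover have "AE x in I01. f x = 0"
    by (rule fundamental_lemma[OF 0(1)]) (use 0(2) in \<open>simp add: reg_apply\<close>)
  ultimately show ?case by (intro exI[of _ "\<lambda>_. 0"]) simp
next
  case (Suc i)
  have "(dderiv ^^ i) (reg f) (nderiv 1 z) = 0" if "z \<in> test_funs" for z
    using Suc.prems(2)[OF that] by (simp add: dderiv_apply that del: One_nat_def)
  then obtain c where c: "(dderiv ^^ i) (reg f) = reg (\<lambda>_. c)"
    using du_Bois_Reymond dderiv_pow_reg_in_distributions[OF Suc.prems(1)] by blast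
  define q where "q x = c * complex_of_real (x ^ i / fact i)" for x
  have q: "smooth q"
    unfolding q_def using smooth_mult[OF smooth_const[of c] smooth_monomial[of "1 / fact i" i]] by simp
  have "nderiv i q = (\<lambda>_. c)" unfolding q_def by (rule nderiv_monomial)
  then have qd: "(dderiv ^^ i) (reg q) = reg (\<lambda>_. c)"
    using dderiv_pow_reg_smooth[OF q, of i] by simp
  have fq: "(\<lambda>x. f x - q x) \<in> Lp 1" by (intro Lp_1_diff Suc.prems smooth_Lp_1 q)
  have "(dderiv ^^ i) (reg (\<lambda>x. f x - q x)) z = 0" if z: "z \<in> test_funs" for z
  proof -
    note t = test_funs_nderiv_pow[OF z, of i]
    have "(dderiv ^^ i) (reg (\<lambda>x. f x - q x)) z = (dderiv ^^ i) (reg f) z - (dderiv ^^ i) (reg q) z"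
      using integrable_mult_test_fun[OF Suc.prems(1) t] integrable_mult_test_fun[OF smooth_Lp_1[OF q] t]
      by (simp add: dderiv_pow_apply z reg_apply t left_diff_distrib right_diff_distrib)
    then show ?thesis by (simp add: c qd)
  qed
  from Suc.IH[OF fq this] obtain p where p: "smooth p" "nderiv i p = (\<lambda>_. 0)" "AE x in I01. f x - q x = p x"
    by blast
  have n: "nderiv (Suc i) h = nderiv 1 (nderiv i h)" for h by (simp add: nderiv_nderiv)
  have "nderiv (Suc i) (\<lambda>x. p x + q x) = (\<lambda>_. 0)"
    unfolding nderiv_smooth_add[OF p(1) q] n p(2) \<open>nderiv i q = (\<lambda>_. c)\<close>
    using nderiv_zero[of 1] by (auto simp: nderiv_Suc fun_eq_iff)
  moreover have "AE x in I01. f x = p x + q x"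
    using p(3) by eventually_elim (simp add: algebra_simps)
  ultimately show ?case using smooth_add[OF p(1) q] by blast
qed

section \<open>Membership in $L_p$\<close>

lemma Lp_borel_measurable: "f \<in> Lp p \<Longrightarrow> f \<in> borel_measurable I01"
  by (simp add: Lp_def)

lemma Lp_add:
  assumes "f \<in> Lp p" "g \<in> Lp p"
  shows "(\<lambda>x. f x + g x) \<in> Lp p"
proof -
  have "integrable I01 (\<lambda>x. norm (f x + g x) ^ p)"
  proof (rule Bochner_Integration.integrable_bound)
    show "integrable I01 (\<lambda>x. 2 ^ p * (norm (f x) ^ p + norm (g x) ^ p))"
      using assms by (simp add: Lp_def)
    show "(\<lambda>x. norm (f x + g x) ^ p) \<in> borel_measurable I01"
      using assms[THEN Lp_borel_measurable] by simp
    have "norm (u + v) ^ p \<le> 2 ^ p * (norm u ^ p + norm v ^ p)" for u v :: complex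
    proof -
      have "norm (u + v) ^ p \<le> (2 * max (norm u) (norm v)) ^ p"
        using norm_triangle_ineq[of u v] by (intro power_mono) auto
      also have "\<dots> \<le> 2 ^ p * (norm u ^ p + norm v ^ p)"
        by (auto simp: power_mult_distrib max_def)
      finally show ?thesis .
    qed
    then show "AE x in I01. norm (norm (f x + g x) ^ p) \<le> norm (2 ^ p * (norm (f x) ^ p + norm (g x) ^ p))"
      by (intro AE_I2) simp
  qed
  then show ?thesis
    using assms[THEN Lp_borel_measurable] by (simp add: Lp_def)
qed

lemma Lp_mult_bounded:
  assumes f: "f \<in> Lp p" and g: "g \<in> borel_measurable I01" and B: "AE x in I01. norm (g x) \<le> B"
  shows "(\<lambda>x. f x * g x) \<in> Lp p"
proof -
  have "integrable I01 (\<lambda>x. norm (f x * g x) ^ p)"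
  proof (rule Bochner_Integration.integrable_bound)
    show "integrable I01 (\<lambda>x. \<bar>B\<bar> ^ p * norm (f x) ^ p)"
      using f by (simp add: Lp_def)
    show "(\<lambda>x. norm (f x * g x) ^ p) \<in> borel_measurable I01"
      using Lp_borel_measurable[OF f] g by simp
    show "AE x in I01. norm (norm (f x * g x) ^ p) \<le> norm (\<bar>B\<bar> ^ p * norm (f x) ^ p)"
      using B
    proof eventually_elim
      case (elim x)
      then have "norm (f x * g x) ^ p \<le> (\<bar>B\<bar> * norm (f x)) ^ p"
        by (intro power_mono) (auto simp: norm_mult mult.commute[of _ "norm (f x)"] intro!: mult_left_mono)
      then show ?case by (simp add: power_mult_distrib power_abs)
    qed
  qed
  then show ?thesis
    using Lp_borel_measurable[OF f] g by (simp add: Lp_def)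
qed

lemma Lp_const: "(\<lambda>_. c) \<in> Lp p"
  by (simp add: Lp_def finite_measure.integrable_const finite_measure_lebesgue_on)

lemma Lp_cmult: "f \<in> Lp p \<Longrightarrow> (\<lambda>x. c * f x) \<in> Lp p"
  using Lp_mult_bounded[of f p "\<lambda>_. c" "norm c"] by (simp add: mult.commute[of c])

lemma Lp_uminus: "f \<in> Lp p \<Longrightarrow> (\<lambda>x. - f x) \<in> Lp p"
  using Lp_cmult[of f p "-1"] by simp

lemma Lp_diff: "f \<in> Lp p \<Longrightarrow> g \<in> Lp p \<Longrightarrow> (\<lambda>x. f x - g x) \<in> Lp p"
  using Lp_add[OF _ Lp_uminus, of f p g] by simp

lemma Lp_zero: "(\<lambda>_. 0) \<in> Lp p"
  by (rule Lp_const)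

lemma Lp_sum: "(\<And>i. i \<in> I \<Longrightarrow> f i \<in> Lp p) \<Longrightarrow> (\<lambda>x. \<Sum>i\<in>I. f i x) \<in> Lp p"
proof (induction I rule: infinite_finite_induct)
  case (insert i I)
  then have "(\<lambda>x. f i x + (\<Sum>j\<in>I. f j x)) \<in> Lp p"
    by (intro Lp_add) auto
  with insert show ?case by simp
qed (simp_all add: Lp_zero)

lemma Lp_bounded:
  "g \<in> borel_measurable I01 \<Longrightarrow> AE x in I01. norm (g x) \<le> B \<Longrightarrow> g \<in> Lp p"
  using Lp_mult_bounded[OF Lp_const[of 1 p], of g B] by simp

lemma Lp_2_mult:
  assumes "f \<in> Lp 2" "g \<in> Lp 2"
  shows "(\<lambda>x. f x * g x) \<in> Lp 1"
  unfolding Lp_1_integrable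
proof (rule Bochner_Integration.integrable_bound)
  show "integrable I01 (\<lambda>x. norm (f x) ^ 2 + norm (g x) ^ 2)"
    using assms by (simp add: Lp_def)
  show "(\<lambda>x. f x * g x) \<in> borel_measurable I01"
    using assms[THEN Lp_borel_measurable] by (intro borel_measurable_times)
  have "norm (u * v) \<le> norm (norm u ^ 2 + norm v ^ 2)" for u v :: complex
  proof -
    have "2 * (norm u * norm v) \<le> norm u ^ 2 + norm v ^ 2"
      using sum_squares_bound[of "norm u" "norm v"] by simp
    moreover have "0 \<le> norm u * norm v" by simp
    ultimately have "norm u * norm v \<le> norm u ^ 2 + norm v ^ 2" by linarith
    then show ?thesis by (simp add: norm_mult)
  qed
  then show "AE x in I01. norm (f x * g x) \<le> norm (norm (f x) ^ 2 + norm (g x) ^ 2)"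
    by (intro AE_I2)
qed

lemma smooth_bounded_I01:
  assumes "smooth f"
  shows "\<exists>B. AE x in I01. norm (f x) \<le> B"
proof -
  have "compact (f ` {0..1})"
    using smooth_continuous[OF assms] by (intro compact_continuous_image) (auto intro: continuous_on_subset)
  then obtain B where "\<forall>x\<in>{0..1}. norm (f x) \<le> B"
    using compact_imp_bounded bounded_iff by (metis imageI)
  then show ?thesis by (intro exI[of _ B] AE_I2) auto
qed

lemma Lp_mult_smooth: "f \<in> Lp p \<Longrightarrow> smooth g \<Longrightarrow> (\<lambda>x. f x * g x) \<in> Lp p"
  using smooth_bounded_I01[of g] Lp_borel_measurable[OF smooth_Lp_1] Lp_mult_bounded by blast

section \<open>Primitives and functions with a weak derivative\<close>

text \<open>For \<open>x\<close> in the unit interval this is the integral from 0 to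
  \<open>x\<close>. Truncating the integrand instead of the domain keeps the measure fixed, so that
  Fubini applies on a fixed square.\<close>

definition prim :: "(real \<Rightarrow> complex) \<Rightarrow> real \<Rightarrow> complex" where
  "prim f x = (LINT t|I01. (if t \<le> x then f t else 0))"

lemma pair_sigma_finite_I01: "pair_sigma_finite I01 I01"
  by (intro pair_sigma_finite.intro finite_measure.axioms(1) finite_measure_lebesgue_on) auto

lemma measurable_ident_I01: "(\<lambda>x. x) \<in> borel_measurable I01"
  by (intro measurable_restrict_space1 measurable_completion) simp

lemma measurable_triangle:
  "{p \<in> space (I01 \<Otimes>\<^sub>M I01). snd p \<le> fst p} \<in> sets (I01 \<Otimes>\<^sub>M I01)"
  "{p \<in> space (I01 \<Otimes>\<^sub>M I01). fst p \<le> snd p} \<in> sets (I01 \<Otimes>\<^sub>M I01)"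
  by (intro borel_measurable_le measurable_compose[OF measurable_fst measurable_ident_I01]
      measurable_compose[OF measurable_snd measurable_ident_I01])+

lemma integrable_truncate:
  assumes "f \<in> Lp 1"
  shows "integrable I01 (\<lambda>t. if t \<le> x then f t else 0)" "integrable I01 (\<lambda>t. if x \<le> t then f t else 0)"
proof -
  have f: "integrable I01 f" using assms Lp_1_integrable by blast
  have *: "{t \<in> space I01. t \<le> x} \<in> sets I01" "{t \<in> space I01. x \<le> t} \<in> sets I01"
    by (intro borel_measurable_le measurable_ident_I01 borel_measurable_const)+
  show "integrable I01 (\<lambda>t. if t \<le> x then f t else 0)" "integrable I01 (\<lambda>t. if x \<le> t then f t else 0)"
    by (rule Bochner_Integration.integrable_bound[OF f];
        use * f in \<open>auto intro!: measurable_If\<close>)+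
qed

lemma integrable_pair:
  assumes f: "f \<in> Lp 1" and g: "g \<in> Lp 1"
    and P: "{p \<in> space (I01 \<Otimes>\<^sub>M I01). P (fst p) (snd p)} \<in> sets (I01 \<Otimes>\<^sub>M I01)"
  shows "integrable (I01 \<Otimes>\<^sub>M I01) (\<lambda>(x, t). if P x t then f x * g t else 0)"
proof -
  interpret pair_sigma_finite I01 I01 by (rule pair_sigma_finite_I01)
  have fi: "integrable I01 f" and gi: "integrable I01 g"
    using f g Lp_1_integrable by blast+
  have fg: "(\<lambda>p. f (fst p) * g (snd p)) \<in> borel_measurable (I01 \<Otimes>\<^sub>M I01)"
    using fi gi
    by (intro borel_measurable_times measurable_compose[OF measurable_fst] measurable_compose[OF measurable_snd])
      auto
  have int: "integrable (I01 \<Otimes>\<^sub>M I01) (\<lambda>p. f (fst p) * g (snd p))"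
  proof (rule Fubini_integrable[OF fg])
    show "integrable I01 (\<lambda>x. LINT y|I01. norm (f (fst (x, y)) * g (snd (x, y))))"
      using fi by (simp add: norm_mult)
    show "AE x in I01. integrable I01 (\<lambda>y. f (fst (x, y)) * g (snd (x, y)))"
      using gi by simp
  qed
  have "integrable (I01 \<Otimes>\<^sub>M I01) (\<lambda>p. if P (fst p) (snd p) then f (fst p) * g (snd p) else 0)"
    by (rule Bochner_Integration.integrable_bound[OF int])
      (use fg P in \<open>auto intro!: measurable_If\<close>)
  then show ?thesis by (simp add: case_prod_beta')
qed

lemma prim_borel_measurable:
  assumes "f \<in> Lp 1"
  shows "prim f \<in> borel_measurable I01"
proof -
  have "(\<lambda>(x, t). if t \<le> x then f t else 0) \<in> borel_measurable (I01 \<Otimes>\<^sub>M I01)"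
    using borel_measurable_integrable[OF integrable_pair[OF Lp_const[of 1] assms measurable_triangle(1)]]
    by (simp only: mult_1)
  then show ?thesis
    unfolding prim_def[abs_def]
    using pair_sigma_finite.axioms(2)[OF pair_sigma_finite_I01]
    by (intro sigma_finite_measure.borel_measurable_lebesgue_integral)
qed

lemma prim_bound: "f \<in> Lp 1 \<Longrightarrow> norm (prim f x) \<le> (LINT t|I01. norm (f t))"
proof -
  assume f: "f \<in> Lp 1"
  have fi: "integrable I01 f" using f Lp_1_integrable by blast
  have "norm (prim f x) \<le> (LINT t|I01. norm (if t \<le> x then f t else 0))"
    unfolding prim_def by (rule integral_norm_bound)
  also have "\<dots> \<le> (LINT t|I01. norm (f t))"
    using fi integrable_truncate(1)[OF f, of x] by (intro integral_mono) auto
  finally show ?thesis .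
qed

lemma prim_Lp: "f \<in> Lp 1 \<Longrightarrow> prim f \<in> Lp p"
  by (rule Lp_bounded[OF prim_borel_measurable AE_I2[OF prim_bound]])

text \<open>By Fubini the two terms on the left are the integrals of \<open>f x * g t\<close> over
  the triangles \<open>t \<le> x\<close> and \<open>x \<le> t\<close>, which together fill the
  square.\<close>

lemma prim_by_parts:
  assumes f: "f \<in> Lp 1" and g: "g \<in> Lp 1"
  shows "(LINT x|I01. f x * prim g x) + (LINT x|I01. prim f x * g x) = (LINT x|I01. f x) * (LINT x|I01. g x)"
proof -
  interpret pair_sigma_finite I01 I01 by (rule pair_sigma_finite_I01)
  have gi: "integrable I01 g" using g Lp_1_integrable by blast
  define J1 J2 where "J1 x t = (if t \<le> x then f x * g t else 0)"
    and "J2 x t = (if x \<le> t then f x * g t else 0)" for x t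
  have J1: "integrable (I01 \<Otimes>\<^sub>M I01) (case_prod J1)" and J2: "integrable (I01 \<Otimes>\<^sub>M I01) (case_prod J2)"
    using integrable_pair[OF f g] measurable_triangle by (auto simp: J1_def[abs_def] J2_def[abs_def])
  have if_mult: "(if b then u * v else 0) = u * (if b then v else 0)" for b and u v :: complex by simp
  have "(LINT x|I01. f x * prim g x) = (LINT x|I01. LINT t|I01. J1 x t)"
    by (simp add: J1_def prim_def if_mult)
  moreover have "(LINT x|I01. prim f x * g x) = (LINT t|I01. LINT x|I01. J2 x t)"
  proof (intro Bochner_Integration.integral_cong refl)
    fix t
    have "(LINT x|I01. J2 x t) = (LINT x|I01. (if x \<le> t then f x else 0) * g t)"
      by (intro Bochner_Integration.integral_cong) (auto simp: J2_def)
    then show "prim f t * g t = (LINT x|I01. J2 x t)" by (simp add: prim_def)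
  qed
  moreover have "\<dots> = (LINT x|I01. LINT t|I01. J2 x t)"
    by (rule Fubini_integral[OF J2])
  moreover have "(LINT x|I01. LINT t|I01. J1 x t) + (LINT x|I01. LINT t|I01. J2 x t) =
      (LINT x|I01. (LINT t|I01. J1 x t) + (LINT t|I01. J2 x t))"
    using integrable_fst'[OF J1] integrable_fst'[OF J2] by simp
  moreover have "\<dots> = (LINT x|I01. f x * (LINT t|I01. g t))"
  proof (intro Bochner_Integration.integral_cong refl)
    fix x
    have t: "integrable I01 (J1 x)" "integrable I01 (J2 x)"
      using integrable_truncate[OF g, of x] unfolding J1_def J2_def if_mult by simp_all
    \<comment> \<open>The two triangles overlap only on the diagonal, which meets each slice in a
      single point.\<close>
    have "AE t in lebesgue. t \<notin> {x}"
      by (intro AE_not_in) (auto intro!: null_sets_completionI)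
    then have ne: "AE t in I01. t \<noteq> x"
      by (subst AE_restrict_space_iff) auto
    have "(LINT t|I01. J1 x t) + (LINT t|I01. J2 x t) = (LINT t|I01. J1 x t + J2 x t)"
      using t by simp
    also have "\<dots> = (LINT t|I01. f x * g t)"
    proof (rule integral_cong_AE)
      show "AE t in I01. J1 x t + J2 x t = f x * g t"
        using ne by eventually_elim (auto simp: J1_def J2_def)
    qed (use t gi in auto)
    finally show "(LINT t|I01. J1 x t) + (LINT t|I01. J2 x t) = f x * (LINT t|I01. g t)" by simp
  qed
  ultimately show ?thesis by simp
qed

lemma prim_nderiv:
  assumes z: "z \<in> test_funs" and x: "x \<in> {0..1}"
  shows "prim (nderiv 1 z) x = z x"
proof -
  have z1: "smooth (nderiv 1 z)" by (rule smooth_nderiv[OF smooth_test_fun[OF z]])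
  have z0: "z 0 = 0" using test_funs_support[OF z] by force
  have "(nderiv 1 z has_integral z x - z 0) {0..x}"
    using x by (intro fundamental_theorem_of_calculus)
      (auto intro: has_vector_derivative_at_within smooth_has_vector_derivative smooth_test_fun z simp del: One_nat_def)
  then have "((\<lambda>t. if t \<in> {0..x} then nderiv 1 z t else 0) has_integral z x) {0..1}"
    using x z0 by (subst has_integral_restrict) auto
  then have "((\<lambda>t. if t \<le> x then nderiv 1 z t else 0) has_integral z x) {0..1}"
    by (rule has_integral_eq[rotated]) auto
  then show ?thesis
    using integrable_truncate(1)[OF smooth_Lp_1[OF z1], of x]
    by (simp add: prim_def lebesgue_integral_eq_integral integral_unique del: One_nat_def)
qed

text \<open>Integration by parts with the derivative of a test function as second factor: its
  primitive is the test function, and the boundary term vanishes because its integral is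
  zero.\<close>

lemma dderiv_reg_prim:
  assumes f: "f \<in> Lp 1"
  shows "dderiv (reg (prim f)) = reg f"
proof (rule functional_eqI[OF extensional_dderiv extensional_reg])
  fix z assume z: "z \<in> test_funs"
  have "(LINT x|I01. f x * prim (nderiv 1 z) x) = (LINT x|I01. f x * z x)"
    by (rule Bochner_Integration.integral_cong) (auto simp: prim_nderiv z simp del: One_nat_def)
  then have "(LINT x|I01. f x * z x) + (LINT x|I01. prim f x * nderiv 1 z x) = 0"
    using prim_by_parts[OF f smooth_Lp_1[OF smooth_test_fun[OF test_funs_nderiv[OF z]]]] LINT_nderiv_eq_0[OF z]
    by (simp del: One_nat_def)
  then show "dderiv (reg (prim f)) z = reg f z"
    using z by (simp add: dderiv_apply reg_apply test_funs_nderiv eq_neg_iff_add_eq_0 neg_eq_iff_add_eq_0 add.commute del: One_nat_def)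
qed

text \<open>The difference of \<open>f\<close> and \<open>prim g\<close> has weak derivative zero
  and is constant by du Bois-Reymond.\<close>

lemma weak_deriv_imp_prim:
  assumes f: "f \<in> Lp 1" and g: "g \<in> Lp 1" and fg: "dderiv (reg f) = reg g"
  shows "\<exists>c. AE x in I01. f x = c + prim g x"
proof -
  have d: "(\<lambda>x. f x - prim g x) \<in> Lp 1" by (intro Lp_diff f prim_Lp g)
  have "reg (\<lambda>x. f x - prim g x) (nderiv 1 z) = 0" if z: "z \<in> test_funs" for z
  proof -
    note z1 = test_funs_nderiv[OF z]
    have "reg (\<lambda>x. f x - prim g x) (nderiv 1 z) = reg f (nderiv 1 z) - reg (prim g) (nderiv 1 z)"
      using integrable_mult_test_fun[OF f z1] integrable_mult_test_fun[OF prim_Lp[OF g] z1]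
      by (simp add: reg_apply z1 left_diff_distrib del: One_nat_def)
    also have "\<dots> = dderiv (reg (prim g)) z - dderiv (reg f) z"
      using z by (simp add: dderiv_apply del: One_nat_def)
    also have "\<dots> = 0" by (simp add: fg dderiv_reg_prim[OF g])
    finally show ?thesis .
  qed
  then obtain c where "reg (\<lambda>x. f x - prim g x) = reg (\<lambda>_. c)"
    using du_Bois_Reymond[OF reg_in_distributions[OF d]] by blast
  from reg_eq_AE[OF d Lp_const this] have "AE x in I01. f x = c + prim g x"
    by eventually_elim (simp add: algebra_simps)
  then show ?thesis by blast
qed

text \<open>A primitive is bounded by the \<open>L\<^sub>1\<close> norm of its integrand.
  Boundedness is what later makes products with merely integrable matrix entries integrable.\<close>

lemma weak_deriv_imp_bounded:
  assumes f: "f \<in> Lp 1" and g: "g \<in> Lp 1" and fg: "dderiv (reg f) = reg g"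
  shows "\<exists>B. AE x in I01. norm (f x) \<le> B"
proof -
  obtain c where "AE x in I01. f x = c + prim g x"
    using weak_deriv_imp_prim[OF assms] by blast
  then have "AE x in I01. norm (f x) \<le> norm c + (LINT t|I01. norm (g t))"
  proof eventually_elim
    case (elim x)
    show ?case
      unfolding elim using prim_bound[OF g, of x] by (intro norm_triangle_le) simp
  qed
  then show ?thesis by blast
qed

lemma AE_I01_ex:
  assumes "AE x in I01. P x" "0 \<le> a" "a < b" "b \<le> 1"
  shows "\<exists>x\<in>{a<..<b}. P x"
proof (rule ccontr)
  assume "\<not> ?thesis"
  then have not: "\<And>x. x \<in> {a<..<b} \<Longrightarrow> \<not> P x" by blast
  have "AE x in lebesgue. x \<in> {0..1} \<longrightarrow> P x"
    using assms(1) by (subst (asm) AE_restrict_space_iff) auto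
  then have "AE x in lebesgue. x \<notin> {a<..<b}"
    by eventually_elim (use not assms in force)
  then have "emeasure lebesgue {a<..<b} = 0"
    by (subst (asm) AE_iff_measurable[of "{a<..<b}"]) auto
  then show False using assms by simp
qed

text \<open>Since \<open>h\<close> vanishes near both ends, it is the primitive of \<open>g\<close>
  without additive constant and \<open>g\<close> has integral zero, so the boundary term in the
  integration by parts drops out.\<close>

lemma LINT_prim_weak_deriv:
  assumes f: "f \<in> Lp 1" and h: "h \<in> Lp 1" and g: "g \<in> Lp 1" and hg: "dderiv (reg h) = reg g"
    and ab: "0 < a" "b < 1" and h0: "\<And>x. x \<notin> {a..b} \<Longrightarrow> h x = 0"
    and g0: "\<And>x. x \<notin> {a..b} \<Longrightarrow> g x = 0"
  shows "(LINT x|I01. f x * h x) = - (LINT x|I01. prim f x * g x)"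
proof -
  obtain c where c: "AE x in I01. h x = c + prim g x"
    using weak_deriv_imp_prim[OF h g hg] by blast
  \<comment> \<open>A point to the left of the support at which the almost everywhere identity
    holds; it forces \<open>c = 0\<close>. The minimum keeps the point in the unit interval even
    when \<open>a\<close> exceeds 1.\<close>
  obtain x where x: "x \<in> {0<..<min a 1}" "h x = c + prim g x"
    using AE_I01_ex[OF c, of 0 "min a 1"] ab by auto
  have "(\<lambda>t. if t \<le> x then g t else 0) = (\<lambda>_. 0)"
    using x(1) g0 by (auto simp: fun_eq_iff)
  then have "prim g x = 0" by (simp add: prim_def)
  moreover have "h x = 0" using x(1) h0 by auto
  ultimately have c0: "c = 0" using x(2) by simp
  \<comment> \<open>A point to the right of the support, where the primitive has already reached the
    full integral of \<open>g\<close>.\<close>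
  obtain y where y: "y \<in> {max b 0<..<1}" "h y = c + prim g y"
    using AE_I01_ex[OF c, of "max b 0" 1] ab by auto
  have "(\<lambda>t. if t \<le> y then g t else 0) = g"
    using y(1) g0 by (auto simp: fun_eq_iff)
  then have "prim g y = (LINT t|I01. g t)" by (simp add: prim_def)
  moreover have "h y = 0" using y(1) h0 by auto
  ultimately have "(LINT t|I01. g t) = 0" using y(2) c0 by simp
  then have "(LINT x|I01. f x * prim g x) = - (LINT x|I01. prim f x * g x)"
    using prim_by_parts[OF f g] by (simp add: eq_neg_iff_add_eq_0)
  moreover have "(LINT x|I01. f x * h x) = (LINT x|I01. f x * prim g x)"
  proof (rule integral_cong_AE)
    show "AE x in I01. f x * h x = f x * prim g x"
      using c by eventually_elim (simp add: c0)
  qed (intro borel_measurable_times Lp_borel_measurable[OF f] Lp_borel_measurable[OF h] prim_borel_measurable g)+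
  ultimately show ?thesis by simp
qed

section \<open>Derivatives of products of a Sobolev and a test function\<close>

text \<open>Representatives of the weak derivatives up to order \<open>m\<close> of one function in
  \<open>W\<^sub>2\<^sup>m\<close>. Carrying them as a family keeps the algebra below independent of
  the choice made in \<open>wderiv\<close>.\<close>

definition wderiv_chain :: "nat \<Rightarrow> (nat \<Rightarrow> real \<Rightarrow> complex) \<Rightarrow> bool" where
  "wderiv_chain m u \<longleftrightarrow>
     (\<forall>a\<le>m. u a \<in> Lp 2) \<and> (\<forall>a<m. dderiv (reg (u a)) = reg (u (Suc a)))"

text \<open>
  \<open>leibniz u z i r s\<close> is the \<open>i\<close>-th derivative of \<open>u\<^sub>r z\<^sup>(\<^sup>s\<^sup>)\<close>; recursion through the product
  rule avoids binomial coefficients.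
\<close>

fun leibniz :: "(nat \<Rightarrow> real \<Rightarrow> complex) \<Rightarrow> (real \<Rightarrow> complex) \<Rightarrow> nat \<Rightarrow> nat \<Rightarrow> nat \<Rightarrow> real \<Rightarrow> complex" where
  "leibniz u z 0 r s = (\<lambda>x. u r x * nderiv s z x)"
| "leibniz u z (Suc i) r s = (\<lambda>x. leibniz u z i (Suc r) s x + leibniz u z i r (Suc s) x)"

lemma leibniz_nderiv: "leibniz u (nderiv k z) i r s = leibniz u z i r (s + k)"
  by (induction i arbitrary: r s) (simp_all add: nderiv_nderiv)

lemma Lp_2_imp_1: "f \<in> Lp 2 \<Longrightarrow> f \<in> Lp 1"
  using Lp_2_subset_Lp_1 by blast

lemma leibniz_Lp_2:
  assumes u: "wderiv_chain m u" and z: "z \<in> test_funs"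
  shows "r + i \<le> m \<Longrightarrow> leibniz u z i r s \<in> Lp 2"
proof (induction i arbitrary: r s)
  case 0
  then show ?case
    using u by (auto simp: wderiv_chain_def intro!: Lp_mult_smooth smooth_nderiv smooth_test_fun[OF z])
next
  case (Suc i)
  then show ?case by (simp add: Lp_add)
qed

lemma leibniz_outside:
  assumes "\<And>x. x \<notin> {a..b} \<Longrightarrow> z x = 0"
  shows "x \<notin> {a..b} \<Longrightarrow> leibniz u z i r s x = 0"
proof (induction i arbitrary: r s)
  case 0
  have "\<forall>x. x \<notin> {a..b} \<longrightarrow> nderiv s z x = 0"
  proof (induction s)
    case (Suc s)
    then show ?case
      using nderiv_1_outside[of a b "nderiv s z"] nderiv_nderiv[of 1 s z]
      by (simp del: atLeastAtMost_iff)
  qed (simp add: assms del: atLeastAtMost_iff)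
  with 0 show ?case by (simp del: atLeastAtMost_iff)
qed (simp del: atLeastAtMost_iff)

lemma integrable_mult_leibniz:
  assumes "wderiv_chain m u" "z \<in> test_funs" "r + i \<le> m" "f \<in> Lp 2"
  shows "integrable I01 (\<lambda>x. f x * leibniz u z i r s x)"
  using Lp_2_mult[OF assms(4) leibniz_Lp_2[OF assms(1-3)]] Lp_1_integrable by blast

lemma smooth_Lp: "smooth f \<Longrightarrow> f \<in> Lp p"
  using Lp_mult_smooth[OF Lp_const[of 1], of f p] by simp

text \<open>The induction starts from the weak derivative of \<open>u r\<close> tested with
  \<open>f\<close> times a derivative of \<open>z\<close>. The compact support comes from
  \<open>z\<close>, so \<open>f\<close> may be any smooth function: a test function, which yields
  the weak derivative, or a polynomial, which yields annihilation.\<close>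

lemma LINT_smooth_leibniz_Suc:
  assumes u: "wderiv_chain m u" and z: "z \<in> test_funs" and f: "smooth f"
  shows "r + i < m \<Longrightarrow> (LINT x|I01. f x * leibniz u z (Suc i) r s x) = - (LINT x|I01. nderiv 1 f x * leibniz u z i r s x)"
proof (induction i arbitrary: r s)
  case 0
  then have r: "u r \<in> Lp 1" "u (Suc r) \<in> Lp 1" "dderiv (reg (u r)) = reg (u (Suc r))"
    using u by (auto simp: wderiv_chain_def intro!: Lp_2_imp_1 simp del: One_nat_def)
  define w where "w = nderiv s z"
  have w: "w \<in> test_funs" "nderiv (Suc s) z = nderiv 1 w"
    using test_funs_nderiv_pow[OF z] nderiv_nderiv[of 1 s z] by (simp_all add: w_def)
  note fw = test_funs_smooth_mult[OF f w(1)]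
  have i1: "integrable I01 (\<lambda>x. u r x * (f x * nderiv 1 w x))"
    by (intro integrable_mult_test_fun r test_funs_smooth_mult f test_funs_nderiv w)
  have i2: "integrable I01 (\<lambda>x. u r x * (nderiv 1 f x * w x))"
    by (intro integrable_mult_test_fun r test_funs_smooth_mult smooth_nderiv f w)
  have i3: "integrable I01 (\<lambda>x. u (Suc r) x * (f x * w x))"
    by (intro integrable_mult_test_fun r fw)
  have "(LINT x|I01. u r x * nderiv 1 (\<lambda>x. f x * w x) x) = - (LINT x|I01. u (Suc r) x * (f x * w x))"
    using fun_cong[OF r(3), of "\<lambda>x. f x * w x"] fw test_funs_nderiv[OF fw]
    by (simp add: dderiv_apply reg_apply minus_equation_iff del: One_nat_def)
  also have "(LINT x|I01. u r x * nderiv 1 (\<lambda>x. f x * w x) x) =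
      (LINT x|I01. u r x * (f x * nderiv 1 w x)) + (LINT x|I01. u r x * (nderiv 1 f x * w x))"
    unfolding nderiv_1_mult[OF f smooth_test_fun[OF w(1)]]
    using i1 i2 by (simp add: distrib_left del: One_nat_def)
  finally have "(LINT x|I01. u (Suc r) x * (f x * w x)) + (LINT x|I01. u r x * (f x * nderiv 1 w x)) =
      - (LINT x|I01. u r x * (nderiv 1 f x * w x))"
    by (simp add: algebra_simps eq_neg_iff_add_eq_0 del: One_nat_def)
  also have "(LINT x|I01. u (Suc r) x * (f x * w x)) + (LINT x|I01. u r x * (f x * nderiv 1 w x)) =
      (LINT x|I01. u (Suc r) x * (f x * w x) + u r x * (f x * nderiv 1 w x))"
    using i1 i3 by (simp del: One_nat_def)
  finally show ?case
    by (simp add: w(2) distrib_left mult.left_commute flip: w_def del: One_nat_def)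
next
  case (Suc i)
  have i: "integrable I01 (\<lambda>x. g x * leibniz u z j k l x)" if "smooth g" "k + j \<le> m" for g j k l
    by (rule integrable_mult_leibniz[OF u z that(2) smooth_Lp[OF that(1)]])
  have f1: "smooth (nderiv 1 f)" by (rule smooth_nderiv[OF f])
  have "(LINT x|I01. f x * leibniz u z (Suc (Suc i)) r s x) =
      (LINT x|I01. f x * leibniz u z (Suc i) (Suc r) s x) + (LINT x|I01. f x * leibniz u z (Suc i) r (Suc s) x)"
    unfolding leibniz.simps(2)[of u z "Suc i"] distrib_left using Suc.prems f
    by (intro Bochner_Integration.integral_add i) auto
  also have "\<dots> = - (LINT x|I01. nderiv 1 f x * leibniz u z i (Suc r) s x)
      - (LINT x|I01. nderiv 1 f x * leibniz u z i r (Suc s) x)"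
    using Suc.prems by (simp add: Suc.IH del: leibniz.simps One_nat_def)
  also have "\<dots> = - (LINT x|I01. nderiv 1 f x * leibniz u z (Suc i) r s x)"
    unfolding leibniz.simps(2)[of u z i] distrib_left
    using Suc.prems i[OF f1, of "Suc r" i s] i[OF f1, of r i "Suc s"] by (simp del: One_nat_def)
  finally show ?case .
qed

lemma LINT_smooth_leibniz:
  assumes u: "wderiv_chain m u" and z: "z \<in> test_funs"
  shows "smooth f \<Longrightarrow> r + i \<le> m \<Longrightarrow>
    (LINT x|I01. f x * leibniz u z i r s x) = (-1) ^ i * (LINT x|I01. nderiv i f x * leibniz u z 0 r s x)"
proof (induction i arbitrary: f)
  case (Suc i)
  have "(LINT x|I01. f x * leibniz u z (Suc i) r s x) = - (LINT x|I01. nderiv 1 f x * leibniz u z i r s x)"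
    using Suc.prems by (intro LINT_smooth_leibniz_Suc[OF u z]) auto
  also have "\<dots> = (-1) ^ Suc i * (LINT x|I01. nderiv i (nderiv 1 f) x * leibniz u z 0 r s x)"
    using Suc.prems by (subst Suc.IH) (auto intro: smooth_nderiv)
  finally show ?case by (simp only: nderiv_nderiv) simp
qed simp

lemma dderiv_reg_leibniz:
  assumes u: "wderiv_chain m u" and z: "z \<in> test_funs" and "r + i < m"
  shows "dderiv (reg (leibniz u z i r s)) = reg (leibniz u z (Suc i) r s)"
proof (rule functional_eqI[OF extensional_dderiv extensional_reg])
  fix v assume v: "v \<in> test_funs"
  show "dderiv (reg (leibniz u z i r s)) v = reg (leibniz u z (Suc i) r s) v"
    using LINT_smooth_leibniz_Suc[OF u z smooth_test_fun[OF v] assms(3), of s] v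
    by (simp add: dderiv_apply reg_apply test_funs_nderiv mult.commute[of _ "v _"] mult.commute[of _ "nderiv 1 v _"] del: leibniz.simps One_nat_def)
qed

text \<open>Confirms that \<open>leibniz\<close> computes the weak derivative that
  \<open>dmult\<close> refers to, so the two agree almost everywhere.\<close>

lemma dderiv_pow_reg_leibniz:
  assumes u: "wderiv_chain m u" and z: "z \<in> test_funs"
  shows "r + i \<le> m \<Longrightarrow> (dderiv ^^ i) (reg (leibniz u z 0 r s)) = reg (leibniz u z i r s)"
proof (induction i)
  case (Suc i)
  then show ?case using dderiv_reg_leibniz[OF u z, of r i s] by (simp del: leibniz.simps)
qed simp

section \<open>Pairing of a distribution with a product of derivatives\<close>

text \<open>The value of the derivative of order \<open>i\<close> of \<sigma> on
  \<open>u\<^sub>r z\<^sup>(\<^sup>s\<^sup>)\<close>, with all \<open>i\<close> derivatives moved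
  onto the product.\<close>

definition pairing :: "(real \<Rightarrow> complex) \<Rightarrow> nat \<Rightarrow> nat \<Rightarrow> nat \<Rightarrow> (nat \<Rightarrow> real \<Rightarrow> complex) \<Rightarrow> (real \<Rightarrow> complex) \<Rightarrow> complex" where
  "pairing \<sigma> i r s u z = (-1) ^ i * (LINT x|I01. \<sigma> x * leibniz u z i r s x)"

lemma pairing_nderiv: "pairing \<sigma> i r s u (nderiv k z) = pairing \<sigma> i r (s + k) u z"
  by (simp add: pairing_def leibniz_nderiv)

lemma pairing_zero: "pairing (\<lambda>_. 0) i r s u z = 0"
  by (simp add: pairing_def)

lemma pairing_cmult: "pairing (\<lambda>x. c * \<sigma> x) i r s u z = c * pairing \<sigma> i r s u z"
  unfolding pairing_def mult.assoc integral_mult_right_zero by (rule mult.left_commute)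

lemma pairing_add:
  assumes "wderiv_chain m u" "z \<in> test_funs" "r + i \<le> m" "\<sigma> \<in> Lp 2" "\<tau> \<in> Lp 2"
  shows "pairing (\<lambda>x. \<sigma> x + \<tau> x) i r s u z = pairing \<sigma> i r s u z + pairing \<tau> i r s u z"
  using integrable_mult_leibniz[OF assms(1-4), of s] integrable_mult_leibniz[OF assms(1-3,5), of s]
  by (simp add: pairing_def distrib_left distrib_right)

text \<open>The recursion of \<open>leibniz\<close> tested with \<sigma>: one derivative of the
  coefficient is traded for one on either factor.\<close>

lemma pairing_Suc:
  assumes "wderiv_chain m u" "z \<in> test_funs" "r + i < m" "\<sigma> \<in> Lp 2"
  shows "pairing \<sigma> (Suc i) r s u z = - pairing \<sigma> i (Suc r) s u z - pairing \<sigma> i r (Suc s) u z"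
  using integrable_mult_leibniz[OF assms(1,2) _ assms(4), of "Suc r" i s]
    integrable_mult_leibniz[OF assms(1,2) _ assms(4), of r i "Suc s"] assms(3)
  by (simp add: pairing_def distrib_left)

text \<open>Raising the order by one and taking a primitive cancel each other. Since primitives are
  bounded, this also turns integrable coefficients into square integrable ones.\<close>

lemma pairing_prim:
  assumes u: "wderiv_chain m u" and z: "z \<in> test_funs" and ri: "r + i < m" and \<sigma>: "\<sigma> \<in> Lp 1"
  shows "pairing (prim \<sigma>) (Suc i) r s u z = pairing \<sigma> i r s u z"
proof -
  obtain a b where ab: "0 < a" "b < 1" "\<And>x. x \<notin> {a..b} \<Longrightarrow> z x = 0"
    using test_funs_support[OF z] by blast
  have "(LINT x|I01. \<sigma> x * leibniz u z i r s x) = - (LINT x|I01. prim \<sigma> x * leibniz u z (Suc i) r s x)"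
    using ri
    by (intro LINT_prim_weak_deriv[OF \<sigma> Lp_2_imp_1[OF leibniz_Lp_2[OF u z]] Lp_2_imp_1[OF leibniz_Lp_2[OF u z]]
          dderiv_reg_leibniz[OF u z ri] ab(1,2)] leibniz_outside[OF ab(3)]) auto
  then show ?thesis by (simp add: pairing_def del: leibniz.simps)
qed

text \<open>Two representatives of the same distribution differ by a polynomial of degree less than
  \<open>i\<close>, and \<open>i\<close> integrations by parts annihilate its pairing.\<close>

lemma pairing_cong_dderiv_pow:
  assumes u: "wderiv_chain m u" and z: "z \<in> test_funs" and ri: "r + i \<le> m"
    and \<sigma>: "\<sigma> \<in> Lp 2" and \<tau>: "\<tau> \<in> Lp 2" and eq: "(dderiv ^^ i) (reg \<sigma>) = (dderiv ^^ i) (reg \<tau>)"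
  shows "pairing \<sigma> i r s u z = pairing \<tau> i r s u z"
proof -
  have d: "(\<lambda>x. \<sigma> x - \<tau> x) \<in> Lp 2" by (rule Lp_diff[OF \<sigma> \<tau>])
  have "(dderiv ^^ i) (reg (\<lambda>x. \<sigma> x - \<tau> x)) v = 0" if v: "v \<in> test_funs" for v
  proof -
    note t = test_funs_nderiv_pow[OF v, of i]
    have "(dderiv ^^ i) (reg (\<lambda>x. \<sigma> x - \<tau> x)) v = (dderiv ^^ i) (reg \<sigma>) v - (dderiv ^^ i) (reg \<tau>) v"
      using integrable_mult_test_fun[OF Lp_2_imp_1[OF \<sigma>] t] integrable_mult_test_fun[OF Lp_2_imp_1[OF \<tau>] t]
      by (simp add: dderiv_pow_apply v reg_apply t left_diff_distrib right_diff_distrib)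
    then show ?thesis by (simp add: eq)
  qed
  then obtain p where p: "smooth p" "nderiv i p = (\<lambda>_. 0)" "AE x in I01. \<sigma> x - \<tau> x = p x"
    using dderiv_pow_reg_eq_0[OF Lp_2_imp_1[OF d]] by blast
  have p2: "p \<in> Lp 2" by (rule smooth_Lp[OF p(1)])
  have "pairing \<sigma> i r s u z = pairing (\<lambda>x. \<tau> x + p x) i r s u z"
  proof -
    have "(LINT x|I01. \<sigma> x * leibniz u z i r s x) = (LINT x|I01. (\<tau> x + p x) * leibniz u z i r s x)"
    proof (rule integral_cong_AE)
      show "AE x in I01. \<sigma> x * leibniz u z i r s x = (\<tau> x + p x) * leibniz u z i r s x"
        using p(3) by eventually_elim (simp add: algebra_simps)
    qed (intro borel_measurable_integrable integrable_mult_leibniz[OF u z ri] \<sigma> Lp_add \<tau> p2)+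
    then show ?thesis by (simp add: pairing_def)
  qed
  also have "\<dots> = pairing \<tau> i r s u z + pairing p i r s u z"
    by (rule pairing_add[OF u z ri \<tau> p2])
  also have "pairing p i r s u z = 0"
    using LINT_smooth_leibniz[OF u z p(1) ri, of s] by (simp add: pairing_def p(2))
  finally show ?thesis by simp
qed

text \<open>One integrable representative makes the choice in \<open>wderiv\<close> meaningful, and
  the fundamental lemma makes it unique almost everywhere.\<close>

lemma wderivI:
  assumes "g \<in> Lp 1" "reg g = (dderiv ^^ i) (reg f)"
  shows "wderiv i f \<in> Lp 1" "reg (wderiv i f) = (dderiv ^^ i) (reg f)" "AE x in I01. wderiv i f x = g x"
proof -
  have "wderiv i f \<in> Lp 1 \<and> reg (wderiv i f) = (dderiv ^^ i) (reg f)"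
    unfolding wderiv_def by (rule someI[of _ g]) (use assms in blast)
  then show *: "wderiv i f \<in> Lp 1" "reg (wderiv i f) = (dderiv ^^ i) (reg f)" by blast+
  show "AE x in I01. wderiv i f x = g x"
    by (rule reg_eq_AE) (use * assms in simp_all)
qed

lemma dmult_eq_pairing:
  assumes u: "wderiv_chain m u" and z: "z \<in> test_funs" and ri: "r + i \<le> m" and \<sigma>: "\<sigma> \<in> Lp 2"
  shows "dmult i ((dderiv ^^ i) (reg \<sigma>)) (u r) z = pairing \<sigma> i r 0 u z"
proof -
  \<comment> \<open>This is the representative that \<open>dmult\<close> selects; it need not be
    \<sigma>, but has the same derivative of order \<open>i\<close>.\<close>
  define \<rho> where "\<rho> = (SOME \<rho>. \<rho> \<in> Lp 2 \<and> (dderiv ^^ i) (reg \<sigma>) = (dderiv ^^ i) (reg \<rho>))"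
  have "\<rho> \<in> Lp 2 \<and> (dderiv ^^ i) (reg \<sigma>) = (dderiv ^^ i) (reg \<rho>)"
    unfolding \<rho>_def by (rule someI[of _ \<sigma>]) (use \<sigma> in blast)
  then have \<rho>: "\<rho> \<in> Lp 2" "(dderiv ^^ i) (reg \<rho>) = (dderiv ^^ i) (reg \<sigma>)" by simp_all
  note l = leibniz_Lp_2[OF u z ri, of 0]
  have lr: "reg (leibniz u z i r 0) = (dderiv ^^ i) (reg (\<lambda>t. u r t * z t))"
    using dderiv_pow_reg_leibniz[OF u z ri, of 0] by simp
  note w = wderivI[OF Lp_2_imp_1[OF l] lr]
  have "(LINT x|I01. \<rho> x * wderiv i (\<lambda>t. u r t * z t) x) = (LINT x|I01. \<rho> x * leibniz u z i r 0 x)"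
  proof (rule integral_cong_AE)
    show "AE x in I01. \<rho> x * wderiv i (\<lambda>t. u r t * z t) x = \<rho> x * leibniz u z i r 0 x"
      using w(3) by eventually_elim simp
  qed (intro borel_measurable_times Lp_borel_measurable[OF \<rho>(1)] Lp_borel_measurable[OF w(1)] Lp_borel_measurable[OF l])+
  then have "dmult i ((dderiv ^^ i) (reg \<sigma>)) (u r) z = pairing \<rho> i r 0 u z"
    using z by (simp add: dmult_def Let_def pairing_def flip: \<rho>_def)
  also have "\<dots> = pairing \<sigma> i r 0 u z"
    by (rule pairing_cong_dderiv_pow[OF u z ri \<rho>(1) \<sigma> \<rho>(2)])
  finally show ?thesis .
qed

lemma dderiv_pow_dmult:
  assumes "wderiv_chain m u" "z \<in> test_funs" "r + i \<le> m" "\<sigma> \<in> Lp 2"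
  shows "(dderiv ^^ k) (dmult i ((dderiv ^^ i) (reg \<sigma>)) (u r)) z = (-1) ^ k * pairing \<sigma> i r k u z"
  using dmult_eq_pairing[OF assms(1) test_funs_nderiv_pow[OF assms(2)] assms(3,4), of k]
  by (simp add: dderiv_pow_apply[OF assms(2)] pairing_nderiv)

text \<open>The lower order part of the differential expression, tested with \<open>z\<close>. The
  outer derivatives have moved onto \<open>z\<close>, and their signs have cancelled those of the
  expression except for the minus sign in the odd terms.\<close>

definition expr_pairing :: "nat \<Rightarrow> (nat \<Rightarrow> real \<Rightarrow> complex) \<Rightarrow> (nat \<Rightarrow> real \<Rightarrow> complex) \<Rightarrow> (real \<Rightarrow> complex) \<Rightarrow> complex" where
  "expr_pairing m \<sigma> u z =
     (\<Sum>k<m. pairing (\<sigma> (2*k)) (m - k) k k u z) +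
     (\<Sum>k<m. pairing (\<sigma> (2*k+1)) (m - k - 1) k (k+1) u z - pairing (\<sigma> (2*k+1)) (m - k - 1) (k+1) k u z)"

lemma diff_expr_eq_expr_pairing:
  assumes u: "wderiv_chain m (\<lambda>k. wderiv k y)" and z: "z \<in> test_funs" and \<sigma>: "\<And>\<nu>. \<sigma> \<nu> \<in> Lp 2"
    and T: "\<And>\<nu>. \<nu> < 2 * m \<Longrightarrow> T \<nu> = (dderiv ^^ sing_order m \<nu>) (reg (\<sigma> \<nu>))"
  shows "diff_expr m T y z = (dderiv ^^ (2*m)) (reg y) z + expr_pairing m \<sigma> (\<lambda>k. wderiv k y) z"
proof -
  let ?u = "\<lambda>k. wderiv k y"
  \<comment> \<open>One sign comes from the expression and an equal one from moving \<open>k\<close>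
    derivatives onto the test function.\<close>
  have sq: "(-1) ^ k * ((-1) ^ k * c) = c" for k and c :: complex
    by (simp add: power_mult_distrib[symmetric] flip: mult.assoc)
  have even: "(-1) ^ k * (dderiv ^^ k) (dmult (sing_order m (2*k)) (T (2*k)) (wderiv k y)) z =
      pairing (\<sigma> (2*k)) (m - k) k k ?u z" if k: "k < m" for k
  proof -
    have s: "sing_order m (2*k) = m - k" by (simp add: sing_order_def)
    have "T (2*k) = (dderiv ^^ (m - k)) (reg (\<sigma> (2*k)))"
      using T[of "2*k"] k s by simp
    then show ?thesis
      using dderiv_pow_dmult[OF u z _ \<sigma>, of k "m - k" k "2*k"] k by (simp add: s sq)
  qed
  have odd: "(-1) ^ (k+1) *
          ((dderiv ^^ (k+1)) (dmult (sing_order m (2*k+1)) (T (2*k+1)) (wderiv k y)) z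
           + (dderiv ^^ k) (dmult (sing_order m (2*k+1)) (T (2*k+1)) (wderiv (k+1) y)) z) =
      pairing (\<sigma> (2*k+1)) (m - k - 1) k (k+1) ?u z - pairing (\<sigma> (2*k+1)) (m - k - 1) (k+1) k ?u z"
    if k: "k < m" for k
  proof -
    have s: "sing_order m (2*k+1) = m - k - 1" by (simp add: sing_order_def)
    have t: "T (2*k+1) = (dderiv ^^ (m - k - 1)) (reg (\<sigma> (2*k+1)))"
      using T[of "2*k+1"] k s by simp
    have "(dderiv ^^ (k+1)) (dmult (m - k - 1) (T (2*k+1)) (wderiv k y)) z =
        (-1) ^ (k+1) * pairing (\<sigma> (2*k+1)) (m - k - 1) k (k+1) ?u z"
      using dderiv_pow_dmult[OF u z _ \<sigma>, of k "m - k - 1" "k+1" "2*k+1"] k unfolding t by simp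
    moreover have "(dderiv ^^ k) (dmult (m - k - 1) (T (2*k+1)) (wderiv (k+1) y)) z =
        (-1) ^ k * pairing (\<sigma> (2*k+1)) (m - k - 1) (k+1) k ?u z"
      using dderiv_pow_dmult[OF u z _ \<sigma>, of "k+1" "m - k - 1" k "2*k+1"] k unfolding t by simp
    ultimately show ?thesis
      unfolding s by (simp add: distrib_left right_diff_distrib sq del: funpow.simps)
  qed
  have "diff_expr m T y z = (dderiv ^^ (2*m)) (reg y) z
     + (\<Sum>k<m. (-1) ^ k * (dderiv ^^ k) (dmult (sing_order m (2*k)) (T (2*k)) (wderiv k y)) z)
     + (\<Sum>k<m. (-1) ^ (k+1) *
          ((dderiv ^^ (k+1)) (dmult (sing_order m (2*k+1)) (T (2*k+1)) (wderiv k y)) z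
           + (dderiv ^^ k) (dmult (sing_order m (2*k+1)) (T (2*k+1)) (wderiv (k+1) y)) z))"
    unfolding diff_expr_def using z by simp
  also have "\<dots> = (dderiv ^^ (2*m)) (reg y) z + expr_pairing m \<sigma> ?u z"
    unfolding expr_pairing_def add.assoc
    by (intro arg_cong2[of _ _ _ _ "(+)"] refl sum.cong even odd) auto
  finally show ?thesis .
qed

section \<open>Reduction of bilinear forms to the shape of the differential expression\<close>

text \<open>The family \<sigma> is chosen before \<open>u\<close> and \<open>z\<close>: the
  coefficients may depend on the form only, not on the function to which the expression is
  applied.\<close>

definition representable :: "nat \<Rightarrow> ((nat \<Rightarrow> real \<Rightarrow> complex) \<Rightarrow> (real \<Rightarrow> complex) \<Rightarrow> complex) \<Rightarrow> bool" where
  "representable m B \<longleftrightarrow> (\<exists>\<sigma>. (\<forall>\<nu>. \<sigma> \<nu> \<in> Lp 2) \<and>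
     (\<forall>u z. wderiv_chain m u \<longrightarrow> z \<in> test_funs \<longrightarrow> B u z = expr_pairing m \<sigma> u z))"

lemma representable_cong:
  assumes "representable m B" "\<And>u z. wderiv_chain m u \<Longrightarrow> z \<in> test_funs \<Longrightarrow> C u z = B u z"
  shows "representable m C"
  using assms unfolding representable_def by metis

lemma representable_zero: "representable m (\<lambda>u z. 0)"
  unfolding representable_def
  by (intro exI[of _ "\<lambda>_ _. 0"]) (simp add: expr_pairing_def pairing_zero Lp_zero)

lemma representable_cmult:
  assumes "representable m B"
  shows "representable m (\<lambda>u z. c * B u z)"
proof -
  obtain \<sigma> where \<sigma>: "\<And>\<nu>. \<sigma> \<nu> \<in> Lp 2"
    "\<And>u z. wderiv_chain m u \<Longrightarrow> z \<in> test_funs \<Longrightarrow> B u z = expr_pairing m \<sigma> u z"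
    using assms unfolding representable_def by blast
  have "expr_pairing m (\<lambda>\<nu> x. c * \<sigma> \<nu> x) u z = c * expr_pairing m \<sigma> u z" for u z
    by (simp add: expr_pairing_def pairing_cmult distrib_left sum_distrib_left right_diff_distrib)
  then show ?thesis
    unfolding representable_def using \<sigma>
    by (intro exI[of _ "\<lambda>\<nu> x. c * \<sigma> \<nu> x"]) (simp add: Lp_cmult)
qed

lemma representable_add:
  assumes "representable m B" "representable m C"
  shows "representable m (\<lambda>u z. B u z + C u z)"
proof -
  obtain \<sigma> where \<sigma>: "\<And>\<nu>. \<sigma> \<nu> \<in> Lp 2"
    "\<And>u z. wderiv_chain m u \<Longrightarrow> z \<in> test_funs \<Longrightarrow> B u z = expr_pairing m \<sigma> u z"
    using assms(1) unfolding representable_def by blast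
  obtain \<tau> where \<tau>: "\<And>\<nu>. \<tau> \<nu> \<in> Lp 2"
    "\<And>u z. wderiv_chain m u \<Longrightarrow> z \<in> test_funs \<Longrightarrow> C u z = expr_pairing m \<tau> u z"
    using assms(2) unfolding representable_def by blast
  have "expr_pairing m (\<lambda>\<nu> x. \<sigma> \<nu> x + \<tau> \<nu> x) u z = expr_pairing m \<sigma> u z + expr_pairing m \<tau> u z"
    if u: "wderiv_chain m u" and z: "z \<in> test_funs" for u z
  proof -
    have "pairing (\<lambda>x. \<sigma> \<nu> x + \<tau> \<nu> x) i r s u z = pairing (\<sigma> \<nu>) i r s u z + pairing (\<tau> \<nu>) i r s u z"
      if "r + i \<le> m" for \<nu> i r s
      by (rule pairing_add[OF u z that \<sigma>(1) \<tau>(1)])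
    then show ?thesis
      unfolding expr_pairing_def
      by (simp add: sum.distrib sum_subtractf algebra_simps)
  qed
  then show ?thesis
    unfolding representable_def using \<sigma> \<tau>
    by (intro exI[of _ "\<lambda>\<nu> x. \<sigma> \<nu> x + \<tau> \<nu> x"]) (simp add: Lp_add)
qed

lemma representable_diff:
  assumes "representable m B" "representable m C"
  shows "representable m (\<lambda>u z. B u z - C u z)"
  using representable_add[OF assms(1) representable_cmult[OF assms(2), of "-1"]] by simp

lemma representable_sum:
  "(\<And>i. i \<in> I \<Longrightarrow> representable m (B i)) \<Longrightarrow> representable m (\<lambda>u z. \<Sum>i\<in>I. B i u z)"
  by (induction I rule: infinite_finite_induct) (simp_all add: representable_zero representable_add)

lemma representable_diagonal:
  assumes k: "k < m" and \<sigma>: "\<sigma> \<in> Lp 2"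
  shows "representable m (pairing \<sigma> (m - k) k k)"
proof -
  define \<rho> where "\<rho> \<nu> = (if \<nu> = 2 * k then \<sigma> else (\<lambda>_. 0))" for \<nu>
  have even: "pairing (\<rho> (2*j)) i r s u z = (if j = k then pairing \<sigma> i r s u z else 0)" for j i r s u z
    by (simp add: \<rho>_def pairing_zero)
  have odd: "pairing (\<rho> (2*j+1)) i r s u z = 0" for j i r s u z
  proof -
    have "2*j+1 \<noteq> 2*k" by presburger
    then show ?thesis by (simp add: \<rho>_def pairing_zero)
  qed
  have "pairing \<sigma> (m - k) k k u z = expr_pairing m \<rho> u z" for u z
    unfolding expr_pairing_def even odd using k by simp
  then show ?thesis
    unfolding representable_def using \<sigma> by (intro exI[of _ \<rho>]) (simp add: \<rho>_def Lp_zero)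
qed

lemma representable_antisymmetric:
  assumes k: "k < m" and \<sigma>: "\<sigma> \<in> Lp 2"
  shows "representable m (\<lambda>u z. pairing \<sigma> (m - k - 1) k (k+1) u z - pairing \<sigma> (m - k - 1) (k+1) k u z)"
proof -
  define \<rho> where "\<rho> \<nu> = (if \<nu> = 2 * k + 1 then \<sigma> else (\<lambda>_. 0))" for \<nu>
  have odd: "pairing (\<rho> (2*j+1)) i r s u z = (if j = k then pairing \<sigma> i r s u z else 0)" for j i r s u z
    by (simp add: \<rho>_def pairing_zero)
  have even: "pairing (\<rho> (2*j)) i r s u z = 0" for j i r s u z
  proof -
    have "2*j \<noteq> 2*k+1" by presburger
    then show ?thesis by (simp add: \<rho>_def pairing_zero)
  qed
  have "pairing \<sigma> (m - k - 1) k (k+1) u z - pairing \<sigma> (m - k - 1) (k+1) k u z = expr_pairing m \<rho> u z" for u z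
    unfolding expr_pairing_def even odd using k by (simp add: sum_subtractf)
  then show ?thesis
    unfolding representable_def using \<sigma> by (intro exI[of _ \<rho>]) (simp add: \<rho>_def Lp_zero)
qed

text \<open>The product rule gives the symmetric combination of the two neighbouring pairings as
  minus a diagonal pairing of one order more. Half of it, together with half of the antisymmetric
  combination, isolates one of the two.\<close>

lemma representable_off_diagonal:
  assumes k: "k < m" and \<sigma>: "\<sigma> \<in> Lp 2"
  shows "representable m (pairing \<sigma> (m - k - 1) k (k+1))"
proof (rule representable_cong)
  show "representable m (\<lambda>u z. 1/2 * (pairing \<sigma> (m - k - 1) k (k+1) u z - pairing \<sigma> (m - k - 1) (k+1) k u z)
      - 1/2 * pairing \<sigma> (m - k) k k u z)"
    by (intro representable_diff representable_cmult representable_antisymmetric representable_diagonal k \<sigma>)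
  fix u z assume u: "wderiv_chain m u" and z: "z \<in> test_funs"
  have "Suc (m - k - 1) = m - k" "k + (m - k - 1) < m" using k by simp_all
  with pairing_Suc[OF u z _ \<sigma>, of k "m - k - 1" k]
  have eq: "pairing \<sigma> (m - k) k k u z =
      - pairing \<sigma> (m - k - 1) (k+1) k u z - pairing \<sigma> (m - k - 1) k (k+1) u z"
    by simp
  show "pairing \<sigma> (m - k - 1) k (k+1) u z =
     1/2 * (pairing \<sigma> (m - k - 1) k (k+1) u z - pairing \<sigma> (m - k - 1) (k+1) k u z)
      - 1/2 * pairing \<sigma> (m - k) k k u z"
    unfolding eq by (simp add: field_simps)
qed

text \<open>Induction on the gap \<open>d\<close> between the two derivative orders. For a gap of at
  least 2 the product rule leaves terms with gaps \<open>d - 1\<close> and \<open>d - 2\<close>,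
  which are already treated.\<close>

lemma representable_pairing_le:
  assumes "r + d \<le> m" "r < m" "\<sigma> \<in> Lp 2"
  shows "representable m (pairing \<sigma> (m - (r + d)) r (r + d))"
  using assms
proof (induction d arbitrary: r \<sigma> rule: less_induct)
  case (less d)
  consider "d = 0" | "d = 1" | e where "d = Suc (Suc e)"
    by (metis One_nat_def not0_implies_Suc)
  then show ?case
  proof cases
    case 1
    then show ?thesis using representable_diagonal less.prems by simp
  next
    case 2
    then show ?thesis using representable_off_diagonal less.prems by simp
  next
    case 3
    show ?thesis
    proof (rule representable_cong)
      \<comment> \<open>In the first term the larger derivative order has dropped by one while the
        order of the distribution has not risen. Passing to \<open>prim \<sigma>\<close> restores
        the prescribed order \<open>m\<close> minus the larger index.\<close>
      show "representable m (\<lambda>u z. (-1) * pairing (prim \<sigma>) (m - (Suc r + e)) (Suc r) (Suc r + e) u z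
          - pairing \<sigma> (m - (r + Suc e)) r (r + Suc e) u z)"
        using less.prems 3
        by (intro representable_diff representable_cmult less.IH prim_Lp Lp_2_imp_1) auto
      fix u z assume u: "wderiv_chain m u" and z: "z \<in> test_funs"
      define i where "i = m - (r + d)"
      have i: "Suc i = m - (Suc r + e)" "Suc i = m - (r + Suc e)" "r + i < m" "Suc r + i < m"
        using less.prems 3 by (simp_all add: i_def)
      have "pairing \<sigma> (Suc i) r (r + Suc e) u z = - pairing \<sigma> i (Suc r) (r + Suc e) u z - pairing \<sigma> i r (r + d) u z"
        using pairing_Suc[OF u z i(3) less.prems(3), of "r + Suc e"] by (simp add: 3)
      moreover have "pairing \<sigma> i (Suc r) (r + Suc e) u z = pairing (prim \<sigma>) (Suc i) (Suc r) (Suc r + e) u z"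
        using pairing_prim[OF u z i(4) Lp_2_imp_1[OF less.prems(3)], of "r + Suc e"] by simp
      ultimately show "pairing \<sigma> (m - (r + d)) r (r + d) u z =
          (-1) * pairing (prim \<sigma>) (m - (Suc r + e)) (Suc r) (Suc r + e) u z
          - pairing \<sigma> (m - (r + Suc e)) r (r + Suc e) u z"
        unfolding i_def[symmetric] i(1,2)[symmetric] by simp
    qed
  qed
qed

text \<open>The same induction with the roles of the factors exchanged: the product rule now moves a
  derivative from \<open>u\<close> to \<open>z\<close>. A gap of 1 needs no separate base case,
  since it leads to the diagonal and to its neighbour on the other side.\<close>

lemma representable_pairing_ge:
  assumes "s + d \<le> m" "s < m" "\<sigma> \<in> Lp 2"
  shows "representable m (pairing \<sigma> (m - (s + d)) (s + d) s)"
  using assms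
proof (induction d arbitrary: s \<sigma> rule: less_induct)
  case (less d)
  show ?case
  proof (cases d)
    case 0
    then show ?thesis using representable_diagonal less.prems by simp
  next
    case (Suc e)
    define i where "i = m - (s + d)"
    have i: "Suc i = m - (s + e)" "s + e + i < m" using less.prems Suc by (simp_all add: i_def)
    \<comment> \<open>For \<open>e = 0\<close> this is the pair \<open>(s, s + 1)\<close> across the
      diagonal. Otherwise the gap has shrunk by two, and a primitive corrects the order as
      before.\<close>
    have 1: "representable m (pairing \<sigma> i (s + e) (Suc s))"
    proof (cases e)
      case 0
      then show ?thesis using representable_off_diagonal less.prems Suc by (simp add: i_def)
    next
      case (Suc e')
      have "representable m (pairing (prim \<sigma>) (m - (Suc s + e')) (Suc s + e') (Suc s))"
        using less.prems \<open>d = Suc e\<close> Suc by (intro less.IH prim_Lp Lp_2_imp_1) auto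
      then show ?thesis
      proof (rule representable_cong)
        fix u z assume u: "wderiv_chain m u" and z: "z \<in> test_funs"
        show "pairing \<sigma> i (s + e) (Suc s) u z = pairing (prim \<sigma>) (m - (Suc s + e')) (Suc s + e') (Suc s) u z"
          using pairing_prim[OF u z i(2) Lp_2_imp_1[OF less.prems(3)], of "Suc s"] i(1) Suc by simp
      qed
    qed
    have 2: "representable m (pairing \<sigma> (Suc i) (s + e) s)"
      unfolding i(1) using less.prems Suc by (intro less.IH) auto
    show ?thesis
    proof (rule representable_cong)
      show "representable m (\<lambda>u z. (-1) * pairing \<sigma> i (s + e) (Suc s) u z - pairing \<sigma> (Suc i) (s + e) s u z)"
        by (intro representable_diff representable_cmult 1 2)
      fix u z assume u: "wderiv_chain m u" and z: "z \<in> test_funs"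
      show "pairing \<sigma> (m - (s + d)) (s + d) s u z =
          (-1) * pairing \<sigma> i (s + e) (Suc s) u z - pairing \<sigma> (Suc i) (s + e) s u z"
        using pairing_Suc[OF u z i(2) less.prems(3), of s] by (simp add: Suc i_def)
    qed
  qed
qed

lemma prim_pow_Lp_1: "f \<in> Lp 1 \<Longrightarrow> (prim ^^ k) f \<in> Lp 1"
  by (induction k) (simp_all add: prim_Lp del: One_nat_def)

lemma pairing_prim_pow:
  assumes u: "wderiv_chain m u" and z: "z \<in> test_funs" and g: "g \<in> Lp 1"
  shows "r + j \<le> m \<Longrightarrow> pairing ((prim ^^ j) g) j r s u z = pairing g 0 r s u z"
proof (induction j)
  case (Suc j)
  then show ?case using pairing_prim[OF u z _ prim_pow_Lp_1[OF g], of r j j s] by simp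
qed simp

text \<open>Taking \<open>j = m - max r s\<close> primitives gives the coefficient the order needed
  for the reduction. For \<open>j > 0\<close> the primitives are square integrable by themselves;
  for \<open>j = 0\<close> one factor has order \<open>m\<close>, and \<open>g\<close> is square
  integrable by assumption.\<close>

lemma representable_monomial:
  assumes "r \<le> m" "s \<le> m" "r < m \<or> s < m" and g: "g \<in> Lp 1" and g2: "g \<in> Lp 2 \<or> r < m \<and> s < m"
  shows "representable m (\<lambda>u z. LINT x|I01. g x * (u r x * nderiv s z x))"
proof -
  define j where "j = m - max r s"
  define \<sigma> where "\<sigma> = (prim ^^ j) g"
  have \<sigma>: "\<sigma> \<in> Lp 2"
  proof (cases j)
    case 0
    then show ?thesis using g2 by (auto simp: \<sigma>_def j_def)
  next
    case (Suc k)
    then show ?thesis using prim_Lp[OF prim_pow_Lp_1[OF g, of k]] by (simp add: \<sigma>_def)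
  qed
  have "representable m (pairing \<sigma> j r s)"
  proof (cases "r \<le> s")
    case True
    then show ?thesis
      using representable_pairing_le[of r "s - r" m \<sigma>] assms(1-3) \<sigma> by (auto simp: j_def)
  next
    case False
    then show ?thesis
      using representable_pairing_ge[of s "r - s" m \<sigma>] assms(1-3) \<sigma> by (auto simp: j_def max_def)
  qed
  then show ?thesis
  proof (rule representable_cong)
    fix u z assume u: "wderiv_chain m u" and z: "z \<in> test_funs"
    show "(LINT x|I01. g x * (u r x * nderiv s z x)) = pairing \<sigma> j r s u z"
      unfolding \<sigma>_def using assms(1,2)
      by (subst pairing_prim_pow[OF u z g]) (auto simp: j_def pairing_def)
  qed
qed

section \<open>Integrability of the matrix entries\<close>

text \<open>A consequence of the completeness of Lebesgue measure. It supplies measurability for the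
  entries that \<open>matrix_class\<close> only requires to vanish almost everywhere.\<close>

lemma AE_zero_borel_measurable:
  assumes "AE x in I01. f x = (0::complex)"
  shows "f \<in> borel_measurable I01"
proof -
  have "AE x in lebesgue. x \<in> {0..1} \<longrightarrow> f x = 0"
    using assms by (subst (asm) AE_restrict_space_iff) auto
  then have "AE x in lebesgue. 0 = indicat_real {0..1} x *\<^sub>R f x"
    by eventually_elim (auto simp: indicator_def)
  then have "(\<lambda>x. indicat_real {0..1} x *\<^sub>R f x) \<in> borel_measurable lebesgue"
    by (rule borel_measurable_AE[rotated]) simp
  then show ?thesis by (simp add: borel_measurable_restrict_space_iff)
qed

lemma AE_zero_Lp: "AE x in I01. f x = 0 \<Longrightarrow> f \<in> Lp p"
  by (rule Lp_bounded[of _ 0]) (auto intro: AE_zero_borel_measurable)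

lemma Lp_mult_AE_bounded:
  assumes "f \<in> Lp p" "g \<in> Lp 1" "\<exists>B. AE x in I01. norm (g x) \<le> B"
  shows "(\<lambda>x. f x * g x) \<in> Lp p"
  using assms Lp_mult_bounded Lp_borel_measurable by blast

lemma matrix_class_Lp_2:
  assumes "F \<in> matrix_class m" "1 \<le> m"
  shows "j \<in> {1..m} \<Longrightarrow> F m j \<in> Lp 2" "k \<in> {m+1..2*m} \<Longrightarrow> F k (m+1) \<in> Lp 2"
proof -
  have "\<forall>k\<in>{m+1..2*m}. \<forall>j\<in>{1..m}. F m j \<in> Lp 2 \<and> F k (m+1) \<in> Lp 2"
    using assms(1) unfolding matrix_class_def by blast
  \<comment> \<open>The square integrability clauses sit under a joint quantifier over
    \<open>k\<close> and \<open>j\<close>; instances from both ranges release them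
    separately.\<close>
  moreover have "2*m \<in> {m+1..2*m}" "1 \<in> {1..m}" using assms(2) by auto
  ultimately show "j \<in> {1..m} \<Longrightarrow> F m j \<in> Lp 2" "k \<in> {m+1..2*m} \<Longrightarrow> F k (m+1) \<in> Lp 2"
    by blast+
qed

lemma matrix_class_Lp_1:
  "F \<in> matrix_class m \<Longrightarrow> k \<in> {m+1..2*m} \<Longrightarrow> j \<in> {1..m} \<Longrightarrow> F k j \<in> Lp 1"
  unfolding matrix_class_def by blast

lemma matrix_class_zero:
  "F \<in> matrix_class m \<Longrightarrow> k \<in> {1..2*m} \<Longrightarrow> j \<in> {1..2*m} \<Longrightarrow>
     k < m \<or> j > m + 1 \<or> (k, j) = (m, m+1) \<Longrightarrow> AE x in I01. F k j x = 0"
  unfolding matrix_class_def by blast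

section \<open>Expansion of the quasi-derivatives\<close>

text \<open>
  Coefficients of the quasi-derivatives of order above \<open>m\<close> after eliminating \<open>y\<^sup>[\<^sup>m\<^sup>]\<close> in favour of
  the weak derivatives of \<open>y\<close>.
\<close>

definition reduced_matrix :: "nat \<Rightarrow> matrix_fun \<Rightarrow> nat \<Rightarrow> nat \<Rightarrow> real \<Rightarrow> complex" where
  "reduced_matrix m F k r x =
     (if r < m then F k (Suc r) x - F k (m+1) x * F m (Suc r) x else F k (m+1) x)"

text \<open>The correction term is a product of two square integrable entries and hence integrable.
  The coefficient of the derivative of order \<open>m\<close> is an entry of column
  \<open>m+1\<close>, which is square integrable.\<close>

lemma reduced_matrix_Lp:
  assumes F: "F \<in> matrix_class m" and m: "1 \<le> m" and k: "k \<in> {m+1..2*m}"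
  shows "reduced_matrix m F k r \<in> Lp 1" "r \<ge> m \<Longrightarrow> reduced_matrix m F k r \<in> Lp 2"
proof -
  note k2 = matrix_class_Lp_2(2)[OF F m k]
  show 2: "reduced_matrix m F k r \<in> Lp 2" if "r \<ge> m"
    using that k2 by (simp add: reduced_matrix_def[abs_def])
  show "reduced_matrix m F k r \<in> Lp 1"
  proof (cases "r < m")
    case True
    then have "(\<lambda>x. F k (Suc r) x - F k (m+1) x * F m (Suc r) x) \<in> Lp 1"
      by (intro Lp_diff Lp_2_mult k2 matrix_class_Lp_1[OF F k] matrix_class_Lp_2(1)[OF F m]) auto
    then show ?thesis using True by (simp add: reduced_matrix_def[abs_def])
  next
    case False
    then show ?thesis using Lp_2_imp_1[OF 2] by simp
  qed
qed

text \<open>What distinguishes the last quasi-derivative from the derivative of order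
  \<open>2*m\<close>, tested with \<open>z\<close>. Row \<open>m\<close> is followed by
  \<open>m\<close> further derivatives, row \<open>m+l\<close> by \<open>m-l\<close>; column
  \<open>Suc r\<close> goes with \<open>u r\<close> because columns are counted from 1.\<close>

definition matrix_form :: "nat \<Rightarrow> matrix_fun \<Rightarrow> (nat \<Rightarrow> real \<Rightarrow> complex) \<Rightarrow> (real \<Rightarrow> complex) \<Rightarrow> complex" where
  "matrix_form m F u z =
     (\<Sum>r<m. (-1) ^ (m+1) * (LINT x|I01. F m (Suc r) x * (u r x * nderiv m z x))) -
     (\<Sum>l\<in>{1..m}. \<Sum>r\<le>m. (-1) ^ (m-l) *
        (LINT x|I01. reduced_matrix m F (m+l) r x * (u r x * nderiv (m-l) z x)))"

text \<open>In the first sum \<open>z\<close> carries \<open>m\<close> derivatives, but row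
  \<open>m\<close> is square integrable. In the second sum \<open>z\<close> carries fewer than
  \<open>m\<close>, so only the terms with \<open>r = m\<close> need square integrability.\<close>

lemma representable_matrix_form:
  assumes F: "F \<in> matrix_class m" and m: "1 \<le> m"
  shows "representable m (matrix_form m F)"
  unfolding matrix_form_def[abs_def]
proof (intro representable_diff representable_sum representable_cmult representable_monomial)
  fix r assume r: "r \<in> {..<m}"
  then show 2: "F m (Suc r) \<in> Lp 2 \<or> r < m \<and> m < m"
    using matrix_class_Lp_2(1)[OF F m] by simp
  then show "F m (Suc r) \<in> Lp 1" using Lp_2_imp_1 by blast
next
  fix l r assume l: "l \<in> {1..m}" and r: "r \<in> {..m}"
  have k: "m + l \<in> {m+1..2*m}" using l by auto
  note red = reduced_matrix_Lp[OF F m k, of r]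
  show "reduced_matrix m F (m + l) r \<in> Lp 1" by (rule red(1))
  show "reduced_matrix m F (m + l) r \<in> Lp 2 \<or> r < m \<and> m - l < m"
    using red(2) l m by force
qed auto

text \<open>Below order \<open>m\<close> the quasi-derivatives are weak derivatives of
  \<open>y\<close>, because the rows vanish. Row \<open>m\<close> expresses
  \<open>y\<^sup>[\<^sup>m\<^sup>]\<close> through them and the weak derivative of order
  \<open>m\<close>; the remaining rows are unfolded by testing with \<open>z\<close>.\<close>

lemma quasi_deriv_expansion:
  assumes F: "F \<in> matrix_class m" and m: "1 \<le> m" and y: "y \<in> quasi_domain m F"
  shows "wderiv_chain m (\<lambda>k. wderiv k y)"
    and "z \<in> test_funs \<Longrightarrow> reg (quasi_deriv F (2*m) y) z =
      (dderiv ^^ (2*m)) (reg y) z + matrix_form m F (\<lambda>k. wderiv k y) z"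
proof -
  define Q where "Q k = quasi_deriv F k y" for k
  define W where "W k = wderiv 1 (Q k)" for k
  define u where "u k = wderiv k y" for k
  define R where "R k x = (\<Sum>j\<in>{1..k}. F k j x * Q (j - 1) x)" for k x
  have Q_Suc: "Q (Suc k) = (\<lambda>x. W k x - R (Suc k) x)" for k
    by (simp add: Q_def W_def R_def)
  have QW: "Q k \<in> Lp 1 \<and> W k \<in> Lp 1 \<and> reg (W k) = dderiv (reg (Q k))" if k: "k < 2*m" for k
  proof -
    have S: "Q k \<in> Sobolev 1 1" using y k by (simp add: quasi_domain_def Q_def)
    then obtain g where g: "g \<in> Lp 1" "reg g = (dderiv ^^ 1) (reg (Q k))"
      unfolding Sobolev_def by blast
    from S wderivI[OF g] show ?thesis
      by (simp add: Sobolev_def W_def)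
  qed
  then have Q1: "Q k \<in> Lp 1" and W1: "W k \<in> Lp 1" and reg_W: "reg (W k) = dderiv (reg (Q k))"
    if "k < 2*m" for k using that by blast+
  \<comment> \<open>The quasi-derivatives below order \<open>2*m\<close> have integrable weak
    derivatives and are therefore bounded, so multiplying by them preserves the class of a matrix
    entry.\<close>
  have Qb: "\<exists>B. AE x in I01. norm (Q k x) \<le> B" if "k < 2*m" for k
    using weak_deriv_imp_bounded[OF Q1[OF that] W1[OF that] reg_W[OF that, symmetric]] .
  have reg_Q: "k < m \<Longrightarrow> reg (Q k) = (dderiv ^^ k) (reg y)" for k
  proof (induction k)
    case 0
    then show ?case by (simp add: Q_def)
  next
    case (Suc k)
    have "AE x in I01. \<forall>j\<in>{1..Suc k}. F (Suc k) j x = 0"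
      using Suc.prems by (intro AE_finite_allI matrix_class_zero[OF F]) auto
    then have "AE x in I01. Q (Suc k) x = W k x"
      by eventually_elim (simp add: Q_Suc R_def)
    then have "reg (Q (Suc k)) = reg (W k)"
      using Suc.prems by (intro reg_cong_AE Q1 W1) auto
    then show ?case using Suc by (simp add: reg_W)
  qed
  have uQ: "u k \<in> Lp 1" "reg (u k) = (dderiv ^^ k) (reg y)" "AE x in I01. u k x = Q k x" if "k < m" for k
    using wderivI[OF Q1 reg_Q] that unfolding u_def by auto
  \<comment> \<open>Row \<open>m\<close> read backwards: it displays the weak derivative of
    \<open>Q (m - 1)\<close>, which is that of \<open>y\<close> of order \<open>m\<close>, as a sum
    of square integrable functions.\<close>
  have row_m: "W (m - 1) = (\<lambda>x. Q m x + (\<Sum>j\<in>{1..m}. F m j x * Q (j - 1) x))"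
    using Q_Suc[of "m - 1"] m by (simp add: R_def)
  have "(\<lambda>x. F m j x * Q (j - 1) x) \<in> Lp 2" if "j \<in> {1..m}" for j
    using that by (intro Lp_mult_AE_bounded matrix_class_Lp_2(1)[OF F m] Q1 Qb) auto
  moreover have "Q m \<in> Lp 2"
    using Qb[of m] Lp_borel_measurable[OF Q1, of m] m by (auto intro: Lp_bounded)
  ultimately have Wm: "W (m - 1) \<in> Lp 2"
    unfolding row_m by (intro Lp_add Lp_sum)
  have "reg (W (m - 1)) = (dderiv ^^ Suc (m - 1)) (reg y)"
    using reg_W[of "m - 1"] reg_Q[of "m - 1"] m by (simp del: Suc_pred Suc_pred' Suc_diff_1)
  then have "reg (W (m - 1)) = (dderiv ^^ m) (reg y)" using m by simp
  from wderivI[OF Lp_2_imp_1[OF Wm] this]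
  have um: "u m \<in> Lp 1" "reg (u m) = (dderiv ^^ m) (reg y)" "AE x in I01. u m x = W (m - 1) x"
    unfolding u_def by auto
  have u2: "u k \<in> Lp 2" if "k \<le> m" for k
  proof (cases "k = m")
    case True
    \<comment> \<open>The chosen representative \<open>u m\<close> agrees with
      \<open>W (m - 1)\<close> only almost everywhere; their difference is a null function and lies
      in every \<open>Lp p\<close>.\<close>
    have "(\<lambda>x. W (m - 1) x + (u m x - W (m - 1) x)) \<in> Lp 2"
      by (intro Lp_add Wm AE_zero_Lp) (use um(3) in eventually_elim, simp)
    with True show ?thesis by simp
  next
    case False
    then have k: "k < m" using that by simp
    obtain B where "AE x in I01. norm (Q k x) \<le> B" using Qb[of k] k by auto
    then have "AE x in I01. norm (u k x) \<le> B" using uQ(3)[OF k] by eventually_elim simp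
    then show ?thesis by (rule Lp_bounded[OF Lp_borel_measurable[OF uQ(1)[OF k]]])
  qed
  have reg_u: "reg (u k) = (dderiv ^^ k) (reg y)" if "k \<le> m" for k
    using that uQ(2) um(2) by (cases "k = m") auto
  show chain: "wderiv_chain m (\<lambda>k. wderiv k y)"
    using u2 reg_u by (simp add: wderiv_chain_def flip: u_def)
  have AE_u: "AE x in I01. \<forall>r<m. Q r x = u r x"
  proof -
    have "AE x in I01. \<forall>r\<in>{..<m}. u r x = Q r x"
      using uQ(3) by (intro AE_finite_allI) auto
    then show ?thesis by eventually_elim simp
  qed
  have shift: "(\<Sum>j\<in>{1..m}. h j) = (\<Sum>r<m. h (Suc r))" for h :: "nat \<Rightarrow> complex"
    by (metis One_nat_def lessThan_Suc_atMost sum.atLeast1_atMost_eq)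
  have AE_Qm: "AE x in I01. Q m x = u m x - (\<Sum>r<m. F m (Suc r) x * u r x)"
    using AE_u um(3)
  proof eventually_elim
    case (elim x)
    then show ?case unfolding row_m shift by simp
  qed
  \<comment> \<open>Entries beyond column \<open>m+1\<close> vanish, and \<open>Q m\<close> is
    eliminated through row \<open>m\<close>. This produces the coefficients of
    \<open>reduced_matrix\<close>.\<close>
  have AE_R: "AE x in I01. R k x = (\<Sum>r\<le>m. reduced_matrix m F k r x * u r x)" if k: "k \<in> {m+1..2*m}" for k
  proof -
    have "AE x in I01. \<forall>j\<in>{m+2..k}. F k j x = 0"
      using k by (intro AE_finite_allI matrix_class_zero[OF F]) auto
    then show ?thesis using AE_u AE_Qm
    proof eventually_elim
      case (elim x)
      have "R k x = (\<Sum>j\<in>{1..m+1}. F k j x * Q (j - 1) x)"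
        unfolding R_def using k elim(1) by (intro sum.mono_neutral_right) auto
      also have "\<dots> = (\<Sum>r<m. F k (Suc r) x * u r x) + F k (m+1) x * Q m x"
        using elim(2) shift[of "\<lambda>j. F k j x * Q (j - 1) x"] by simp
      also have "\<dots> = (\<Sum>r<m. reduced_matrix m F k r x * u r x) + F k (m+1) x * u m x"
        unfolding elim(3)
        by (simp add: reduced_matrix_def sum_distrib_left right_diff_distrib left_diff_distrib sum_subtractf mult.assoc)
      also have "\<dots> = (\<Sum>r\<le>m. reduced_matrix m F k r x * u r x)"
        by (simp add: reduced_matrix_def flip: lessThan_Suc_atMost)
      finally show ?case .
    qed
  qed
  have R1: "R k \<in> Lp 1" if k: "k \<in> {m+1..2*m}" for k
  proof -
    have "(\<lambda>x. F k j x * Q (j - 1) x) \<in> Lp 1" if j: "j \<in> {1..k}" for j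
    proof -
      have "F k j \<in> Lp 1"
        \<comment> \<open>The entry lies to the left of, in, or to the right of column
          \<open>m+1\<close>: integrable, square integrable, or almost everywhere zero.\<close>
        using matrix_class_Lp_1[OF F k, of j] Lp_2_imp_1[OF matrix_class_Lp_2(2)[OF F m k]]
          AE_zero_Lp[OF matrix_class_zero[OF F, of k j]] j k
        by (cases j "m+1" rule: linorder_cases) auto
      then show ?thesis using j k by (intro Lp_mult_AE_bounded Q1 Qb) auto
    qed
    then show ?thesis unfolding R_def[abs_def] by (intro Lp_sum)
  qed
  \<comment> \<open>Each passage to the next quasi-derivative moves one derivative onto
    \<open>z\<close> and subtracts the new row, so row \<open>m + k\<close> ends with
    \<open>l - k\<close> derivatives on \<open>z\<close>.\<close>
  have expand: "l \<le> m \<Longrightarrow> z \<in> test_funs \<Longrightarrow> reg (Q (m + l)) z =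
      (-1) ^ l * reg (Q m) (nderiv l z) - (\<Sum>k\<in>{1..l}. (-1) ^ (l - k) * (LINT x|I01. R (m + k) x * nderiv (l - k) z x))" for l z
  proof (induction l arbitrary: z)
    case 0
    then show ?case by simp
  next
    case (Suc l)
    note z = Suc.prems(2)
    have "reg (Q (m + Suc l)) z = reg (W (m + l)) z - (LINT x|I01. R (m + Suc l) x * z x)"
      using Suc.prems(1) integrable_mult_test_fun[OF W1 z, of "m + l"] integrable_mult_test_fun[OF R1 z, of "m + Suc l"]
      by (simp add: reg_apply z Q_Suc left_diff_distrib)
    also have "reg (W (m + l)) z = - reg (Q (m + l)) (nderiv 1 z)"
      using Suc.prems(1) by (simp add: reg_W dderiv_apply z del: One_nat_def)
    also have "\<dots> = (-1) ^ Suc l * reg (Q m) (nderiv (l + 1) z) -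
        (\<Sum>k\<in>{1..l}. (-1) ^ Suc (l - k) * (LINT x|I01. R (m + k) x * nderiv (l - k + 1) z x))"
      using Suc.prems(1) Suc.IH[OF _ test_funs_nderiv[OF z]]
      by (simp only: nderiv_nderiv) (simp add: sum_negf)
    also have "(\<Sum>k\<in>{1..l}. (-1) ^ Suc (l - k) * (LINT x|I01. R (m + k) x * nderiv (l - k + 1) z x)) =
        (\<Sum>k\<in>{1..l}. (-1) ^ (Suc l - k) * (LINT x|I01. R (m + k) x * nderiv (Suc l - k) z x))"
      by (intro sum.cong) (auto simp: Suc_diff_le)
    finally show ?case by simp
  qed
  have int_sum: "(LINT x|I01. (\<Sum>r\<in>I. c r x * u r x) * v x) = (\<Sum>r\<in>I. LINT x|I01. c r x * (u r x * v x))"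
    if "\<And>r. r \<in> I \<Longrightarrow> (\<lambda>x. c r x * u r x) \<in> Lp 1" "v \<in> test_funs" for I c v
    using integrable_mult_test_fun[OF that(1) that(2)]
    by (simp add: sum_distrib_right mult.assoc)
  have ub: "\<exists>B. AE x in I01. norm (u r x) \<le> B" if "r < m" for r
    using weak_deriv_imp_bounded[of "u r" "u (Suc r)"] u2[of r] u2[of "Suc r"] that reg_u[of r] reg_u[of "Suc r"]
    by (simp add: Lp_2_imp_1 del: One_nat_def)
  have row1: "(\<lambda>x. F m (Suc r) x * u r x) \<in> Lp 1" if "r \<in> {..<m}" for r
    using that by (intro Lp_2_mult matrix_class_Lp_2(1)[OF F m] u2) auto
  have red1: "(\<lambda>x. reduced_matrix m F k r x * u r x) \<in> Lp 1" if "k \<in> {m+1..2*m}" "r \<in> {..m}" for k r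
  proof (cases "r = m")
    case True
    then show ?thesis using that reduced_matrix_Lp(2)[OF F m that(1)] by (intro Lp_2_mult u2) auto
  next
    case False
    then show ?thesis
      using that by (intro Lp_mult_AE_bounded reduced_matrix_Lp(1)[OF F m] ub Lp_2_imp_1 u2) auto
  qed
  show "reg (quasi_deriv F (2*m) y) z =
      (dderiv ^^ (2*m)) (reg y) z + matrix_form m F (\<lambda>k. wderiv k y) z" if z: "z \<in> test_funs"
  proof -
    note zm = test_funs_nderiv_pow[OF z]
    have S1: "(\<lambda>x. \<Sum>r<m. F m (Suc r) x * u r x) \<in> Lp 1" by (intro Lp_sum row1)
    \<comment> \<open>The \<open>m\<close> derivatives on \<open>z\<close> applied to the part
      \<open>u m\<close> of \<open>Q m\<close> rebuild the derivative of \<open>y\<close> of order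
      \<open>2*m\<close>; the rest of row \<open>m\<close> gives the first sum of
      \<open>matrix_form\<close>.\<close>
    have "(-1) ^ m * reg (Q m) (nderiv m z) =
        (-1) ^ m * (reg (u m) (nderiv m z) - reg (\<lambda>x. \<Sum>r<m. F m (Suc r) x * u r x) (nderiv m z))"
    proof -
      have "reg (Q m) = reg (\<lambda>x. u m x - (\<Sum>r<m. F m (Suc r) x * u r x))"
        using m by (intro reg_cong_AE Q1 Lp_diff um(1) S1 AE_Qm) auto
      then show ?thesis
        using integrable_mult_test_fun[OF um(1) zm] integrable_mult_test_fun[OF S1 zm]
        by (simp add: reg_apply zm left_diff_distrib)
    qed
    also have "\<dots> = (dderiv ^^ m) (reg (u m)) z - (-1) ^ m * reg (\<lambda>x. \<Sum>r<m. F m (Suc r) x * u r x) (nderiv m z)"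
      by (simp add: dderiv_pow_apply z right_diff_distrib)
    also have "(dderiv ^^ m) (reg (u m)) = (dderiv ^^ (2*m)) (reg y)"
      by (simp add: um(2) mult_2 funpow_add)
    also have "(-1) ^ m * reg (\<lambda>x. \<Sum>r<m. F m (Suc r) x * u r x) (nderiv m z) =
        - (\<Sum>r<m. (-1) ^ (m+1) * (LINT x|I01. F m (Suc r) x * (u r x * nderiv m z x)))"
      using int_sum[of "{..<m}" "\<lambda>r. F m (Suc r)" "nderiv m z", OF row1 zm] by (simp add: reg_apply zm sum_distrib_left sum_negf)
    finally have lead: "(-1) ^ m * reg (Q m) (nderiv m z) = (dderiv ^^ (2*m)) (reg y) z +
        (\<Sum>r<m. (-1) ^ (m+1) * (LINT x|I01. F m (Suc r) x * (u r x * nderiv m z x)))" by simp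
    have rest: "(-1) ^ (m - l) * (LINT x|I01. R (m + l) x * nderiv (m - l) z x) =
        (\<Sum>r\<le>m. (-1) ^ (m-l) * (LINT x|I01. reduced_matrix m F (m+l) r x * (u r x * nderiv (m-l) z x)))"
      if l: "l \<in> {1..m}" for l
    proof -
      have k: "m + l \<in> {m+1..2*m}" using l by auto
      have "reg (R (m + l)) = reg (\<lambda>x. \<Sum>r\<le>m. reduced_matrix m F (m + l) r x * u r x)"
        by (intro reg_cong_AE R1 k Lp_sum red1 AE_R)
      then have "(LINT x|I01. R (m + l) x * nderiv (m - l) z x) =
          (LINT x|I01. (\<Sum>r\<le>m. reduced_matrix m F (m + l) r x * u r x) * nderiv (m - l) z x)"
        using reg_apply[OF zm] by metis
      also have "\<dots> = (\<Sum>r\<le>m. LINT x|I01. reduced_matrix m F (m+l) r x * (u r x * nderiv (m-l) z x))"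
        by (rule int_sum[OF red1[OF k] zm])
      finally show ?thesis by (simp add: sum_distrib_left)
    qed
    have "reg (Q (2*m)) z = (dderiv ^^ (2*m)) (reg y) z + matrix_form m F u z"
      using expand[OF order_refl z] rest
      by (simp add: mult_2 lead[unfolded mult_2] matrix_form_def)
    then show ?thesis by (simp add: Q_def u_def[abs_def])
  qed
qed

theorem theorem2p6:
  fixes m :: nat
  assumes "m \<ge> 1"
  shows "(\<forall>F\<in>matrix_class m. \<exists>T\<in>coeff_space m. associated m F T) \<and>
         matrix_class m = (\<Union>T\<in>coeff_space m. associated_matrices m T)"
proof -
  have "\<exists>T\<in>coeff_space m. associated m F T" if F: "F \<in> matrix_class m" for F
  proof -
    obtain \<sigma> where \<sigma>: "\<And>\<nu>. \<sigma> \<nu> \<in> Lp 2"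
      "\<And>u z. wderiv_chain m u \<Longrightarrow> z \<in> test_funs \<Longrightarrow> matrix_form m F u z = expr_pairing m \<sigma> u z"
      using representable_matrix_form[OF F assms] unfolding representable_def by blast
    \<comment> \<open>Each \<sigma> is differentiated as often as its singularity order prescribes.
      The restriction to indices below \<open>2*m\<close> makes \<open>T\<close> an element of the
      extensional product \<open>coeff_space m\<close>.\<close>
    define T where "T = (\<lambda>\<nu>\<in>{..<2*m}. (dderiv ^^ sing_order m \<nu>) (reg (\<sigma> \<nu>)))"
    have "T \<in> coeff_space m"
      using \<sigma>(1) by (auto simp: T_def coeff_space_def Wneg_eq)
    moreover have "associated m F T"
      unfolding associated_def
    proof
      fix y assume y: "y \<in> quasi_domain m F"
      note chain = quasi_deriv_expansion(1)[OF F assms y]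
      show "diff_expr m T y = reg (quasi_deriv F (2*m) y)"
      proof (rule functional_eqI[OF _ extensional_reg])
        show "diff_expr m T y \<in> extensional test_funs" by (simp add: diff_expr_def)
        fix z assume z: "z \<in> test_funs"
        have "diff_expr m T y z = (dderiv ^^ (2*m)) (reg y) z + expr_pairing m \<sigma> (\<lambda>k. wderiv k y) z"
          by (rule diff_expr_eq_expr_pairing[OF chain z \<sigma>(1)]) (simp add: T_def)
        then show "diff_expr m T y z = reg (quasi_deriv F (2*m) y) z"
          using quasi_deriv_expansion(2)[OF F assms y z] \<sigma>(2)[OF chain z] by simp
      qed
    qed
    ultimately show ?thesis by blast
  qed
  \<comment> \<open>The union is contained in the class by the definition of
    \<open>associated_matrices\<close>, so existence of coefficients for every matrix gives the
    equality.\<close>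
  then show ?thesis by (auto simp: associated_matrices_def)
qed

end
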